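(* Let $(\mathfrak g,[\cdot,\cdot]_{\mathfrak g},\phi_{\mathfrak g})$ and $(\mathfrak h,[\cdot,\cdot]_{\mathfrak h},\phi_{\mathfrak h})$ be regular Hom-Lie algebras such that the short exact sequences of Hom-Lie algebra morphisms $0\to\mathrm{Inn}(\mathfrak h)\to\mathrm{Der}(\mathfrak h)\xrightarrow{\pi}\mathrm{Out}(\mathfrak h)\to0$ and $0\to\mathrm{Cen}(\mathfrak h)\to\mathfrak h\xrightarrow{\mathrm{ad}}\mathrm{Inn}(\mathfrak h)\to0$ are diagonal non-abelian extensions. Let $\bar\rho:\mathfrak g\to\mathrm{Out}(\mathfrak h)$ be a Hom-Lie algebra morphism, and let $[\mathrm d_\rho\omega]\in\mathcal H^3(\mathfrak g;\hat\rho)$ be the cohomology class associated with $\bar\rho$. Then $\bar\rho$ is an extensible homomorphism if and only if $$[\mathrm d_\rho\omega]=[0].$$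
   Context: All vector spaces are over an algebraically closed field $\mathbb K$ of characteristic $0$. Hom-Lie algebras. A (multiplicative) Hom-Lie algebra $(\mathfrak g,[\cdot,\cdot]_{\mathfrak g},\phi_{\mathfrak g})$ is a vector space $\mathfrak g$ with a skew-symmetric bilinear bracket and a linear map $\phi_{\mathfrak g}:\mathfrak g\to\mathfrak g$ preserving the bracket such that $[\phi_{\mathfrak g}(x),[y,z]_{\mathfrak g}]_{\mathfrak g}+[\phi_{\mathfrak g}(y),[z,x]_{\mathfrak g}]_{\mathfrak g}+[\phi_{\mathfrak g}(z),[x,y]_{\mathfrak g}]_{\mathfrak g}=0$. It is regular if $\phi_{\mathfrak g}$ is an algebra automorphism (in particular invertible). All Hom-Lie algebras here are assumed regular. A morphism $f:\mathfrak g\to\mathfrak h$ of Hom-Lie algebras is a linear map with $f[x,y]_{\mathfrak g}=[f(x),f(y)]_{\mathfrak h}$ and $f\circ\phi_{\mathfrak g}=\phi_{\mathfrak h}\circ f$. The center is $\mathrm{Cen}(\mathfrak h)=\{u\in\mathfrak h: [u,v]_{\mathfrak h}=0\ \forall v\in\mathfrak h\}$. Derivations. For a vector space $V$ and $\beta\in GL(V)$, put $\mathrm{Ad}_\beta(A)=\beta A\beta^{-1}$ and $[A,B]_\beta=\beta A\beta^{-1}B\beta^{-1}-\beta B\beta^{-1}A\beta^{-1}$; then $(\mathfrak{gl}(V),[\cdot,\cdot]_\beta,\mathrm{Ad}_\beta)$ is a regular Hom-Lie algebra. A derivation of $\mathfrak h$ is a linear map $D:\mathfrak h\to\mathfrak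 h$ with $D[u,v]_{\mathfrak h}=[\phi_{\mathfrak h}(u),(\mathrm{Ad}_{\phi_{\mathfrak h}^{-1}}D)(v)]_{\mathfrak h}+[(\mathrm{Ad}_{\phi_{\mathfrak h}^{-1}}D)(u),\phi_{\mathfrak h}(v)]_{\mathfrak h}$ for all $u,v$. The set $\mathrm{Der}(\mathfrak h)$ of derivations is a Hom-Lie subalgebra of $(\mathfrak{gl}(\mathfrak h),[\cdot,\cdot]_{\phi_{\mathfrak h}},\mathrm{Ad}_{\phi_{\mathfrak h}})$. With $\mathrm{ad}_u(v)=[u,v]_{\mathfrak h}$, the set $\mathrm{Inn}(\mathfrak h)=\{\mathrm{ad}_u:u\in\mathfrak h\}$ is an ideal of $\mathrm{Der}(\mathfrak h)$; $\mathrm{Out}(\mathfrak h)=\mathrm{Der}(\mathfrak h)/\mathrm{Inn}(\mathfrak h)$ carries the induced Hom-Lie algebra structure and $\pi:\mathrm{Der}(\mathfrak h)\to\mathrm{Out}(\mathfrak h)$ is the quotient map. Extensions. A non-abelian extension of $\mathfrak g$ by $\mathfrak h$ is a short exact sequence of Hom-Lie algebra morphisms $0\to\mathfrak h\xrightarrow{\iota}\hat{\mathfrak g}\xrightarrow{p}\mathfrak g\to0$, with $\hat{\mathfrak g}$ a Hom-Lie algebra. It is diagonal if $\hat{\mathfrak g}$ has a $\phi_{\hat{\mathfrak g}}$-invariant subspace $X$ with $\mathfrak h\oplus X=\hat{\mathfrak g}$; equivalently, there is a linear map $s:\mathfrak g\to\hat{\mathfrak g}$ with $p\circ s=\mathrm{Id}$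 and $\phi_{\hat{\mathfrak g}}\circ s=s\circ\phi_{\mathfrak g}$ (a diagonal section of $p$). In particular, a diagonal section of $\pi$ is a linear map $s:\mathrm{Out}(\mathfrak h)\to\mathrm{Der}(\mathfrak h)$ with $\pi\circ s=\mathrm{Id}$ that intertwines the structure map of $\mathrm{Out}(\mathfrak h)$ (induced by $\mathrm{Ad}_{\phi_{\mathfrak h}}$) with $\mathrm{Ad}_{\phi_{\mathfrak h}}$. Representations and cohomology. A representation of $\mathfrak g$ on $V$ with respect to $\beta\in\mathfrak{gl}(V)$ is a linear map $\rho:\mathfrak g\to\mathfrak{gl}(V)$ with $\rho(\phi_{\mathfrak g}(x))\circ\beta=\beta\circ\rho(x)$ and $\rho([x,y]_{\mathfrak g})\circ\beta=\rho(\phi_{\mathfrak g}(x))\circ\rho(y)-\rho(\phi_{\mathfrak g}(y))\circ\rho(x)$. The $k$-Hom-cochains are $C^k_{\phi_{\mathfrak g},\beta}(\mathfrak g;V)=\{f:\wedge^k\mathfrak g\to V\text{ linear}: \beta\circ f=f\circ\phi_{\mathfrak g}^{\otimes k}\}$, and for $k\ge1$ the coboundary operator is $$(\mathrm d_\rho f)(x_1,\dots,x_{k+1})=\sum_{i=1}^{k+1}(-1)^{i+1}\rho(\phi_{\mathfrak g}^{k-1}(x_i))f(x_1,\dots,\widehat{x_i},\dots,x_{k+1})+\sum_{i<j}(-1)^{i+j}f([x_i,x_j]_{\mathfrak g},\phi_{\mathfrak g}(x_1),\dots,\widehat{\phi_{\mathfrak g}(x_i)},\dots,\widehat{\phi_{\mathfrak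 g}(x_j)},\dots,\phi_{\mathfrak g}(x_{k+1})).$$ $\mathcal Z^k(\mathfrak g;\rho)$, $\mathcal B^k(\mathfrak g;\rho)$ are the $k$-cocycles and $k$-coboundaries, and $\mathcal H^k(\mathfrak g;\rho)=\mathcal Z^k(\mathfrak g;\rho)/\mathcal B^k(\mathfrak g;\rho)$. The class $[\mathrm d_\rho\omega]$. Given $\bar\rho$, choose a diagonal section $s$ of $\pi$, put $\rho_x=s(\bar\rho_x)\in\mathrm{Der}(\mathfrak h)$ (then $\rho_{\phi_{\mathfrak g}(x)}\circ\phi_{\mathfrak h}=\phi_{\mathfrak h}\circ\rho_x$), and choose a linear map $\omega:\mathfrak g\wedge\mathfrak g\to\mathfrak h$ with (i) $\phi_{\mathfrak h}\circ\omega=\omega\circ\phi_{\mathfrak g}^{\otimes2}$ and (ii) $[\rho_x,\rho_y]_{\phi_{\mathfrak h}}-\rho_{[x,y]_{\mathfrak g}}=\mathrm{ad}_{\omega(x,y)}$ for all $x,y\in\mathfrak g$; such choices exist under the stated hypotheses. Let $\mathrm d_\rho\omega$ be the formal coboundary ($\rho$ need not be a representation): $$(\mathrm d_\rho\omega)(x,y,z)=\rho_{\phi_{\mathfrak g}(x)}(\omega(y,z))-\omega([x,y]_{\mathfrak g},\phi_{\mathfrak g}(z))+\text{cyclic permutations of }(x,y,z).$$ It takes values in $\mathrm{Cen}(\mathfrak h)$. Each $\rho_x$ preserves $\mathrm{Cen}(\mathfrak h)$, and $\hat\rho_x:=\rho_x|_{\mathrm{Cen}(\mathfrak h)}$ defines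 a representation $\hat\rho$ of $\mathfrak g$ on $\mathrm{Cen}(\mathfrak h)$ with respect to $\phi_{\mathfrak h}|_{\mathrm{Cen}(\mathfrak h)}$, depending only on $\bar\rho$. The cochain $\mathrm d_\rho\omega$ is a $3$-cocycle in $\mathcal Z^3(\mathfrak g;\hat\rho)$ and its class $[\mathrm d_\rho\omega]\in\mathcal H^3(\mathfrak g;\hat\rho)$ is independent of the choices of $s$ and $\omega$. Extensible homomorphism. A Hom-Lie algebra morphism $\bar\rho:\mathfrak g\to\mathrm{Out}(\mathfrak h)$ is called extensible if there exist a diagonal section $s$ of $\pi$ and a linear map $\omega:\mathfrak g\wedge\mathfrak g\to\mathfrak h$ such that, with $\rho_x=s(\bar\rho_x)$, one has $\rho_{\phi_{\mathfrak g}(x)}\circ\phi_{\mathfrak h}=\phi_{\mathfrak h}\circ\rho_x$, conditions (i) and (ii) hold, and $\rho_{\phi_{\mathfrak g}(x)}(\omega(y,z))-\omega([x,y]_{\mathfrak g},\phi_{\mathfrak g}(z))+\text{cyclic permutations of }(x,y,z)=0$ for all $x,y,z\in\mathfrak g$. *)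

theory Defs
  imports "HOL-Algebra.Algebraic_Closure"
begin

section \<open>Hom-Lie algebras\<close>

text \<open>
  The bracket of a Hom-Lie algebra is the field \<open>mult\<close> of the underlying \<open>module\<close> record, so
  that \<open>x \<otimes> y\<close> stands for the bracket of \<open>x\<close> and \<open>y\<close>.  The field \<open>one\<close> of the record has no
  meaning here and is never constrained.
\<close>

record ('k, 'a) hom_lie = "('k, 'a) module" +
  phi :: "'a \<Rightarrow> 'a"

definition linear_map ::
  "('k, 'r) ring_scheme \<Rightarrow> ('k, 'a, 'm) module_scheme \<Rightarrow> ('k, 'b, 'n) module_scheme
     \<Rightarrow> ('a \<Rightarrow> 'b) \<Rightarrow> bool" where
  "linear_map K V W f \<longleftrightarrow>
     f \<in> carrier V \<rightarrow> carrier W \<and>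
     (\<forall>x\<in>carrier V. \<forall>y\<in>carrier V. f (x \<oplus>\<^bsub>V\<^esub> y) = f x \<oplus>\<^bsub>W\<^esub> f y) \<and>
     (\<forall>a\<in>carrier K. \<forall>x\<in>carrier V. f (a \<odot>\<^bsub>V\<^esub> x) = a \<odot>\<^bsub>W\<^esub> f x)"

locale hom_lie_algebra = field K + module K L
  for K :: "('k, 'r) ring_scheme" and L :: "('k, 'a, 'm) hom_lie_scheme" +
  assumes bracket_closed:
      "x \<in> carrier L \<Longrightarrow> y \<in> carrier L \<Longrightarrow> x \<otimes>\<^bsub>L\<^esub> y \<in> carrier L"
    and bracket_add_left:
      "x \<in> carrier L \<Longrightarrow> y \<in> carrier L \<Longrightarrow> z \<in> carrier L \<Longrightarrow>
         (x \<oplus>\<^bsub>L\<^esub> y) \<otimes>\<^bsub>L\<^esub> z = x \<otimes>\<^bsub>L\<^esub> z \<oplus>\<^bsub>L\<^esub> y \<otimes>\<^bsub>L\<^esub> z"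
    and bracket_add_right:
      "x \<in> carrier L \<Longrightarrow> y \<in> carrier L \<Longrightarrow> z \<in> carrier L \<Longrightarrow>
         x \<otimes>\<^bsub>L\<^esub> (y \<oplus>\<^bsub>L\<^esub> z) = x \<otimes>\<^bsub>L\<^esub> y \<oplus>\<^bsub>L\<^esub> x \<otimes>\<^bsub>L\<^esub> z"
    and bracket_smult_left:
      "a \<in> carrier K \<Longrightarrow> x \<in> carrier L \<Longrightarrow> y \<in> carrier L \<Longrightarrow>
         (a \<odot>\<^bsub>L\<^esub> x) \<otimes>\<^bsub>L\<^esub> y = a \<odot>\<^bsub>L\<^esub> (x \<otimes>\<^bsub>L\<^esub> y)"
    and bracket_smult_right:
      "a \<in> carrier K \<Longrightarrow> x \<in> carrier L \<Longrightarrow> y \<in> carrier L \<Longrightarrow>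
         x \<otimes>\<^bsub>L\<^esub> (a \<odot>\<^bsub>L\<^esub> y) = a \<odot>\<^bsub>L\<^esub> (x \<otimes>\<^bsub>L\<^esub> y)"
    and bracket_skew:
      "x \<in> carrier L \<Longrightarrow> y \<in> carrier L \<Longrightarrow> x \<otimes>\<^bsub>L\<^esub> y = \<ominus>\<^bsub>L\<^esub> (y \<otimes>\<^bsub>L\<^esub> x)"
    and phi_linear: "linear_map K L L (phi L)"
    and phi_bracket:
      "x \<in> carrier L \<Longrightarrow> y \<in> carrier L \<Longrightarrow> phi L (x \<otimes>\<^bsub>L\<^esub> y) = phi L x \<otimes>\<^bsub>L\<^esub> phi L y"
    and hom_jacobi:
      "x \<in> carrier L \<Longrightarrow> y \<in> carrier L \<Longrightarrow> z \<in> carrier L \<Longrightarrow>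
         phi L x \<otimes>\<^bsub>L\<^esub> (y \<otimes>\<^bsub>L\<^esub> z) \<oplus>\<^bsub>L\<^esub> phi L y \<otimes>\<^bsub>L\<^esub> (z \<otimes>\<^bsub>L\<^esub> x)
           \<oplus>\<^bsub>L\<^esub> phi L z \<otimes>\<^bsub>L\<^esub> (x \<otimes>\<^bsub>L\<^esub> y) = \<zero>\<^bsub>L\<^esub>"

locale regular_hom_lie_algebra = hom_lie_algebra +
  assumes phi_bij: "bij_betw (phi L) (carrier L) (carrier L)"

definition hom_lie_morphism ::
  "('k, 'r) ring_scheme \<Rightarrow> ('k, 'a, 'm) hom_lie_scheme \<Rightarrow> ('k, 'b, 'n) hom_lie_scheme
     \<Rightarrow> ('a \<Rightarrow> 'b) \<Rightarrow> bool" where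
  "hom_lie_morphism K L M f \<longleftrightarrow>
     linear_map K L M f \<and>
     (\<forall>x\<in>carrier L. \<forall>y\<in>carrier L. f (x \<otimes>\<^bsub>L\<^esub> y) = f x \<otimes>\<^bsub>M\<^esub> f y) \<and>
     (\<forall>x\<in>carrier L. f (phi L x) = phi M (f x))"

definition center :: "('k, 'a, 'm) hom_lie_scheme \<Rightarrow> 'a set" where
  "center L = {u \<in> carrier L. \<forall>v\<in>carrier L. u \<otimes>\<^bsub>L\<^esub> v = \<zero>\<^bsub>L\<^esub>}"

definition Cen :: "('k, 'a, 'm) hom_lie_scheme \<Rightarrow> ('k, 'a, 'm) hom_lie_scheme" where
  "Cen L = L\<lparr>carrier := center L\<rparr>"

definition fact_hom_lie ::
  "('k, 'a, 'm) hom_lie_scheme \<Rightarrow> 'a set \<Rightarrow> ('k, 'a set) hom_lie" where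
  "fact_hom_lie L I =
     \<lparr>carrier = a_rcosets\<^bsub>L\<^esub> I, monoid.mult = rcoset_mult L I, one = I +>\<^bsub>L\<^esub> \<one>\<^bsub>L\<^esub>,
      ring.zero = I, add = set_add L,
      smult = (\<lambda>a A. \<Union>x\<in>A. I +>\<^bsub>L\<^esub> (a \<odot>\<^bsub>L\<^esub> x)),
      phi = (\<lambda>A. \<Union>x\<in>A. I +>\<^bsub>L\<^esub> phi L x)\<rparr>"


section \<open>Derivations\<close>

text \<open>
  Endomorphisms of a space with carrier \<open>C\<close> are represented by functions that are \<open>undefined\<close>
  outside \<open>C\<close>, so that they are equal as soon as they agree on \<open>C\<close>.  The inverse of \<open>\<beta>\<close> is
  \<open>inv_into C \<beta>\<close>.
\<close>

definition Ad :: "('k, 'a, 'm) module_scheme \<Rightarrow> ('a \<Rightarrow> 'a) \<Rightarrow> ('a \<Rightarrow> 'a) \<Rightarrow> 'a \<Rightarrow> 'a" where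
  "Ad V \<beta> A = (\<lambda>v\<in>carrier V. \<beta> (A (inv_into (carrier V) \<beta> v)))"

definition gl_bracket ::
  "('k, 'a, 'm) module_scheme \<Rightarrow> ('a \<Rightarrow> 'a) \<Rightarrow> ('a \<Rightarrow> 'a) \<Rightarrow> ('a \<Rightarrow> 'a) \<Rightarrow> 'a \<Rightarrow> 'a" where
  "gl_bracket V \<beta> A B =
     (let \<beta>' = inv_into (carrier V) \<beta> in
      (\<lambda>v\<in>carrier V. \<beta> (A (\<beta>' (B (\<beta>' v)))) \<ominus>\<^bsub>V\<^esub> \<beta> (B (\<beta>' (A (\<beta>' v))))))"

definition hom_gl ::
  "('k, 'r) ring_scheme \<Rightarrow> ('k, 'a, 'm) module_scheme \<Rightarrow> ('a \<Rightarrow> 'a)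
     \<Rightarrow> ('k, 'a \<Rightarrow> 'a) hom_lie" where
  "hom_gl K V \<beta> =
     \<lparr>carrier = {A \<in> extensional (carrier V). linear_map K V V A},
      monoid.mult = gl_bracket V \<beta>, one = undefined,
      ring.zero = (\<lambda>v\<in>carrier V. \<zero>\<^bsub>V\<^esub>),
      add = (\<lambda>A B. \<lambda>v\<in>carrier V. A v \<oplus>\<^bsub>V\<^esub> B v),
      smult = (\<lambda>a A. \<lambda>v\<in>carrier V. a \<odot>\<^bsub>V\<^esub> A v),
      phi = Ad V \<beta>\<rparr>"

definition derivations ::
  "('k, 'r) ring_scheme \<Rightarrow> ('k, 'a, 'm) hom_lie_scheme \<Rightarrow> ('a \<Rightarrow> 'a) set" where
  "derivations K L =
     {D \<in> carrier (hom_gl K L (phi L)).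
        let D' = Ad L (inv_into (carrier L) (phi L)) D in
        \<forall>u\<in>carrier L. \<forall>v\<in>carrier L.
          D (u \<otimes>\<^bsub>L\<^esub> v) = phi L u \<otimes>\<^bsub>L\<^esub> D' v \<oplus>\<^bsub>L\<^esub> D' u \<otimes>\<^bsub>L\<^esub> phi L v}"

definition Der ::
  "('k, 'r) ring_scheme \<Rightarrow> ('k, 'a, 'm) hom_lie_scheme \<Rightarrow> ('k, 'a \<Rightarrow> 'a) hom_lie" where
  "Der K L = (hom_gl K L (phi L))\<lparr>carrier := derivations K L\<rparr>"

definition ad :: "('k, 'a, 'm) hom_lie_scheme \<Rightarrow> 'a \<Rightarrow> 'a \<Rightarrow> 'a" where
  "ad L u = (\<lambda>v\<in>carrier L. u \<otimes>\<^bsub>L\<^esub> v)"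

definition Inn ::
  "('k, 'r) ring_scheme \<Rightarrow> ('k, 'a, 'm) hom_lie_scheme \<Rightarrow> ('k, 'a \<Rightarrow> 'a) hom_lie" where
  "Inn K L = (Der K L)\<lparr>carrier := ad L ` carrier L\<rparr>"

definition Out ::
  "('k, 'r) ring_scheme \<Rightarrow> ('k, 'a, 'm) hom_lie_scheme \<Rightarrow> ('k, ('a \<Rightarrow> 'a) set) hom_lie" where
  "Out K L = fact_hom_lie (Der K L) (carrier (Inn K L))"

definition out_proj ::
  "('k, 'r) ring_scheme \<Rightarrow> ('k, 'a, 'm) hom_lie_scheme \<Rightarrow> ('a \<Rightarrow> 'a) \<Rightarrow> ('a \<Rightarrow> 'a) set" where
  "out_proj K L D = carrier (Inn K L) +>\<^bsub>Der K L\<^esub> D"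


section \<open>Extensions\<close>

definition extension ::
  "('k, 'r) ring_scheme \<Rightarrow> ('k, 'a, 'm) hom_lie_scheme \<Rightarrow> ('a \<Rightarrow> 'b) \<Rightarrow>
     ('k, 'b, 'n) hom_lie_scheme \<Rightarrow> ('b \<Rightarrow> 'c) \<Rightarrow> ('k, 'c, 'l) hom_lie_scheme \<Rightarrow> bool" where
  "extension K H i E p G \<longleftrightarrow>
     regular_hom_lie_algebra K H \<and> regular_hom_lie_algebra K E \<and> regular_hom_lie_algebra K G \<and>
     hom_lie_morphism K H E i \<and> hom_lie_morphism K E G p \<and>
     inj_on i (carrier H) \<and> i ` carrier H = a_kernel E G p \<and> p ` carrier E = carrier G"

definition diagonal_extension ::
  "('k, 'r) ring_scheme \<Rightarrow> ('k, 'a, 'm) hom_lie_scheme \<Rightarrow> ('a \<Rightarrow> 'b) \<Rightarrow>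
     ('k, 'b, 'n) hom_lie_scheme \<Rightarrow> ('b \<Rightarrow> 'c) \<Rightarrow> ('k, 'c, 'l) hom_lie_scheme \<Rightarrow> bool" where
  "diagonal_extension K H i E p G \<longleftrightarrow>
     extension K H i E p G \<and>
     (\<exists>W. submodule W K E \<and> phi E ` W \<subseteq> W \<and>
          i ` carrier H \<inter> W = {\<zero>\<^bsub>E\<^esub>} \<and> i ` carrier H <+>\<^bsub>E\<^esub> W = carrier E)"

definition diagonal_section ::
  "('k, 'r) ring_scheme \<Rightarrow> ('k, 'b, 'n) hom_lie_scheme \<Rightarrow> ('b \<Rightarrow> 'c)
     \<Rightarrow> ('k, 'c, 'l) hom_lie_scheme \<Rightarrow> ('c \<Rightarrow> 'b) \<Rightarrow> bool" where
  "diagonal_section K E p G s \<longleftrightarrow>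
     linear_map K G E s \<and>
     (\<forall>x\<in>carrier G. p (s x) = x) \<and>
     (\<forall>x\<in>carrier G. phi E (s x) = s (phi G x))"


section \<open>Cohomology\<close>

text \<open>
  A linear map on the \<open>k\<close>-th exterior power of \<open>L\<close> is represented by the corresponding
  alternating multilinear map, a function on lists of length \<open>k\<close>.
\<close>

definition tuples :: "nat \<Rightarrow> ('k, 'a, 'm) module_scheme \<Rightarrow> 'a list set" where
  "tuples k L = {xs. length xs = k \<and> set xs \<subseteq> carrier L}"

definition alternating_maps ::
  "('k, 'r) ring_scheme \<Rightarrow> nat \<Rightarrow> ('k, 'a, 'm) module_scheme \<Rightarrow> ('k, 'v, 'n) module_scheme
     \<Rightarrow> ('a list \<Rightarrow> 'v) set" where
  "alternating_maps K k L V =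
     {f \<in> tuples k L \<rightarrow>\<^sub>E carrier V.
        (\<forall>xs\<in>tuples k L. \<forall>i<k. \<forall>y\<in>carrier L. \<forall>z\<in>carrier L.
           f (xs[i := y \<oplus>\<^bsub>L\<^esub> z]) = f (xs[i := y]) \<oplus>\<^bsub>V\<^esub> f (xs[i := z])) \<and>
        (\<forall>xs\<in>tuples k L. \<forall>i<k. \<forall>a\<in>carrier K. \<forall>y\<in>carrier L.
           f (xs[i := a \<odot>\<^bsub>L\<^esub> y]) = a \<odot>\<^bsub>V\<^esub> f (xs[i := y])) \<and>
        (\<forall>xs\<in>tuples k L. \<forall>i j. i < j \<longrightarrow> j < k \<longrightarrow> xs ! i = xs ! j \<longrightarrow> f xs = \<zero>\<^bsub>V\<^esub>)}"

definition cochains ::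
  "('k, 'r) ring_scheme \<Rightarrow> nat \<Rightarrow> ('k, 'a, 'm) hom_lie_scheme \<Rightarrow> ('k, 'v, 'n) module_scheme
     \<Rightarrow> ('v \<Rightarrow> 'v) \<Rightarrow> ('a list \<Rightarrow> 'v) set" where
  "cochains K k L V \<beta> =
     {f \<in> alternating_maps K k L V. \<forall>xs\<in>tuples k L. \<beta> (f xs) = f (map (phi L) xs)}"

definition cochain_module ::
  "('k, 'r) ring_scheme \<Rightarrow> nat \<Rightarrow> ('k, 'a, 'm) hom_lie_scheme \<Rightarrow> ('k, 'v, 'n) module_scheme
     \<Rightarrow> ('v \<Rightarrow> 'v) \<Rightarrow> ('k, 'a list \<Rightarrow> 'v) module" where
  "cochain_module K k L V \<beta> =
     \<lparr>carrier = cochains K k L V \<beta>, monoid.mult = undefined, one = undefined,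
      ring.zero = (\<lambda>xs\<in>tuples k L. \<zero>\<^bsub>V\<^esub>),
      add = (\<lambda>f g. \<lambda>xs\<in>tuples k L. f xs \<oplus>\<^bsub>V\<^esub> g xs),
      smult = (\<lambda>a f. \<lambda>xs\<in>tuples k L. a \<odot>\<^bsub>V\<^esub> f xs)\<rparr>"

definition omit :: "nat \<Rightarrow> 'a list \<Rightarrow> 'a list" where
  "omit i xs = take i xs @ drop (Suc i) xs"

text \<open>
  List positions start at \<open>0\<close>, hence the sign \<open>(-1)\<^sup>i\<close> in the first sum; the sign \<open>(-1)\<^bsup>i+j\<^esup>\<close> in
  the second one is unaffected.  The degree \<open>k\<close> of \<open>f\<close> is meant to be at least \<open>1\<close>.
\<close>

definition coboundary ::
  "('k, 'r) ring_scheme \<Rightarrow> nat \<Rightarrow> ('k, 'a, 'm) hom_lie_scheme \<Rightarrow> ('k, 'v, 'n) module_scheme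
     \<Rightarrow> ('a \<Rightarrow> 'v \<Rightarrow> 'v) \<Rightarrow> ('a list \<Rightarrow> 'v) \<Rightarrow> 'a list \<Rightarrow> 'v" where
  "coboundary K k L V \<rho> f =
     (\<lambda>xs\<in>tuples (Suc k) L.
        (\<Oplus>\<^bsub>V\<^esub>i\<in>{..k}. ((\<ominus>\<^bsub>K\<^esub> \<one>\<^bsub>K\<^esub>) [^]\<^bsub>K\<^esub> i)
            \<odot>\<^bsub>V\<^esub> \<rho> ((phi L ^^ (k - 1)) (xs ! i)) (f (omit i xs)))
        \<oplus>\<^bsub>V\<^esub>
        (\<Oplus>\<^bsub>V\<^esub>j\<in>{..k}. \<Oplus>\<^bsub>V\<^esub>i\<in>{..<j}. ((\<ominus>\<^bsub>K\<^esub> \<one>\<^bsub>K\<^esub>) [^]\<^bsub>K\<^esub> (i + j))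
            \<odot>\<^bsub>V\<^esub> f ((xs ! i \<otimes>\<^bsub>L\<^esub> xs ! j) # map (phi L) (omit i (omit j xs)))))"

definition cocycles ::
  "('k, 'r) ring_scheme \<Rightarrow> nat \<Rightarrow> ('k, 'a, 'm) hom_lie_scheme \<Rightarrow> ('k, 'v, 'n) module_scheme
     \<Rightarrow> ('v \<Rightarrow> 'v) \<Rightarrow> ('a \<Rightarrow> 'v \<Rightarrow> 'v) \<Rightarrow> ('a list \<Rightarrow> 'v) set" where
  "cocycles K k L V \<beta> \<rho> =
     {f \<in> cochains K k L V \<beta>. coboundary K k L V \<rho> f = \<zero>\<^bsub>cochain_module K (Suc k) L V \<beta>\<^esub>}"

text \<open>The complex starts in degree \<open>1\<close>, so there are no nonzero coboundaries of degree \<open>1\<close>.\<close>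

definition coboundaries ::
  "('k, 'r) ring_scheme \<Rightarrow> nat \<Rightarrow> ('k, 'a, 'm) hom_lie_scheme \<Rightarrow> ('k, 'v, 'n) module_scheme
     \<Rightarrow> ('v \<Rightarrow> 'v) \<Rightarrow> ('a \<Rightarrow> 'v \<Rightarrow> 'v) \<Rightarrow> ('a list \<Rightarrow> 'v) set" where
  "coboundaries K k L V \<beta> \<rho> =
     (if k \<le> 1 then {\<zero>\<^bsub>cochain_module K k L V \<beta>\<^esub>}
      else coboundary K (k - 1) L V \<rho> ` cochains K (k - 1) L V \<beta>)"

definition fact_module ::
  "('k, 'a, 'm) module_scheme \<Rightarrow> 'a set \<Rightarrow> ('k, 'a set) module" where
  "fact_module M N =
     \<lparr>carrier = a_rcosets\<^bsub>M\<^esub> N, monoid.mult = undefined, one = undefined,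
      ring.zero = N, add = set_add M,
      smult = (\<lambda>a A. \<Union>x\<in>A. N +>\<^bsub>M\<^esub> (a \<odot>\<^bsub>M\<^esub> x))\<rparr>"

definition cohomology ::
  "('k, 'r) ring_scheme \<Rightarrow> nat \<Rightarrow> ('k, 'a, 'm) hom_lie_scheme \<Rightarrow> ('k, 'v, 'n) module_scheme
     \<Rightarrow> ('v \<Rightarrow> 'v) \<Rightarrow> ('a \<Rightarrow> 'v \<Rightarrow> 'v) \<Rightarrow> ('k, ('a list \<Rightarrow> 'v) set) module" where
  "cohomology K k L V \<beta> \<rho> =
     fact_module ((cochain_module K k L V \<beta>)\<lparr>carrier := cocycles K k L V \<beta> \<rho>\<rparr>)
       (coboundaries K k L V \<beta> \<rho>)"

definition cohomology_class ::
  "('k, 'r) ring_scheme \<Rightarrow> nat \<Rightarrow> ('k, 'a, 'm) hom_lie_scheme \<Rightarrow> ('k, 'v, 'n) module_scheme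
     \<Rightarrow> ('v \<Rightarrow> 'v) \<Rightarrow> ('a \<Rightarrow> 'v \<Rightarrow> 'v) \<Rightarrow> ('a list \<Rightarrow> 'v) \<Rightarrow> ('a list \<Rightarrow> 'v) set" where
  "cohomology_class K k L V \<beta> \<rho> f =
     coboundaries K k L V \<beta> \<rho> +>\<^bsub>(cochain_module K k L V \<beta>)\<lparr>carrier := cocycles K k L V \<beta> \<rho>\<rparr>\<^esub> f"


section \<open>The obstruction class and extensible homomorphisms\<close>

definition formal_coboundary ::
  "('k, 'a, 'm) hom_lie_scheme \<Rightarrow> ('k, 'b, 'n) hom_lie_scheme \<Rightarrow> ('a \<Rightarrow> 'b \<Rightarrow> 'b)
     \<Rightarrow> ('a list \<Rightarrow> 'b) \<Rightarrow> 'a \<Rightarrow> 'a \<Rightarrow> 'a \<Rightarrow> 'b" where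
  "formal_coboundary G H \<rho> \<omega> x y z =
     (let t = (\<lambda>x y z. \<rho> (phi G x) (\<omega> [y, z]) \<ominus>\<^bsub>H\<^esub> \<omega> [x \<otimes>\<^bsub>G\<^esub> y, phi G z])
      in t x y z \<oplus>\<^bsub>H\<^esub> t y z x \<oplus>\<^bsub>H\<^esub> t z x y)"

definition lifting_data ::
  "('k, 'r) ring_scheme \<Rightarrow> ('k, 'a, 'm) hom_lie_scheme \<Rightarrow> ('k, 'b, 'n) hom_lie_scheme
     \<Rightarrow> ('a \<Rightarrow> ('b \<Rightarrow> 'b) set) \<Rightarrow> (('b \<Rightarrow> 'b) set \<Rightarrow> 'b \<Rightarrow> 'b) \<Rightarrow> ('a list \<Rightarrow> 'b) \<Rightarrow> bool" where
  "lifting_data K G H rbar s \<omega> \<longleftrightarrow>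
     diagonal_section K (Der K H) (out_proj K H) (Out K H) s \<and>
     \<omega> \<in> alternating_maps K 2 G H \<and>
     (\<forall>x\<in>carrier G. \<forall>y\<in>carrier G. phi H (\<omega> [x, y]) = \<omega> [phi G x, phi G y]) \<and>
     (\<forall>x\<in>carrier G. \<forall>y\<in>carrier G.
        s (rbar x) \<otimes>\<^bsub>Der K H\<^esub> s (rbar y) \<ominus>\<^bsub>Der K H\<^esub> s (rbar (x \<otimes>\<^bsub>G\<^esub> y)) = ad H (\<omega> [x, y]))"

definition extensible ::
  "('k, 'r) ring_scheme \<Rightarrow> ('k, 'a, 'm) hom_lie_scheme \<Rightarrow> ('k, 'b, 'n) hom_lie_scheme
     \<Rightarrow> ('a \<Rightarrow> ('b \<Rightarrow> 'b) set) \<Rightarrow> bool" where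
  "extensible K G H rbar \<longleftrightarrow>
     (\<exists>s \<omega>. lifting_data K G H rbar s \<omega> \<and>
        (\<forall>x\<in>carrier G. \<forall>u\<in>carrier H. s (rbar (phi G x)) (phi H u) = phi H (s (rbar x) u)) \<and>
        (\<forall>x\<in>carrier G. \<forall>y\<in>carrier G. \<forall>z\<in>carrier G.
           formal_coboundary G H (\<lambda>x. s (rbar x)) \<omega> x y z = \<zero>\<^bsub>H\<^esub>))"

text \<open>
  The induced representation on the centre and the obstruction class are obtained from auxiliary
  choices but do not depend on them; \<open>THE\<close> refers to the common value of all choices.
\<close>

definition center_rep ::
  "('k, 'r) ring_scheme \<Rightarrow> ('k, 'a, 'm) hom_lie_scheme \<Rightarrow> ('k, 'b, 'n) hom_lie_scheme
     \<Rightarrow> ('a \<Rightarrow> ('b \<Rightarrow> 'b) set) \<Rightarrow> 'a \<Rightarrow> 'b \<Rightarrow> 'b" where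
  "center_rep K G H rbar =
     (THE r. \<exists>s. diagonal_section K (Der K H) (out_proj K H) (Out K H) s \<and>
                 r = (\<lambda>x\<in>carrier G. \<lambda>u\<in>center H. s (rbar x) u))"

definition obstruction_class ::
  "('k, 'r) ring_scheme \<Rightarrow> ('k, 'a, 'm) hom_lie_scheme \<Rightarrow> ('k, 'b, 'n) hom_lie_scheme
     \<Rightarrow> ('a \<Rightarrow> ('b \<Rightarrow> 'b) set) \<Rightarrow> ('a list \<Rightarrow> 'b) set" where
  "obstruction_class K G H rbar =
     (THE c. \<exists>s \<omega>. lifting_data K G H rbar s \<omega> \<and>
        c = cohomology_class K 3 G (Cen H) (phi H) (center_rep K G H rbar)
              (\<lambda>xs\<in>tuples 3 G.
                 formal_coboundary G H (\<lambda>x. s (rbar x)) \<omega> (xs ! 0) (xs ! 1) (xs ! 2)))"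

end

theory Submission
  imports Defs
begin

text \<open>
  The section \<open>s\<close> lifts the outer action \<open>rbar\<close> to maps \<open>\<rho> x = s (rbar x)\<close> which represent \<open>G\<close> only up
  to inner derivations; \<open>\<omega>\<close> records the error, and its formal coboundary measures how far the pair
  \<open>(\<rho>, \<omega>)\<close> is from being the factor set of an extension.  The error \<open>\<omega>\<close> is itself determined only up to
  centre-valued 2-cochains \<open>\<theta>\<close>, and subtracting such a \<open>\<theta>\<close> from \<open>\<omega>\<close> subtracts exactly \<open>d \<theta>\<close> from the
  formal coboundary.  So if the formal coboundary of one choice \<open>(s, \<omega>)\<close> is a coboundary \<open>d \<theta>\<close>, then
  \<open>(s, \<omega> - \<theta>)\<close> shows that \<open>rbar\<close> is extensible.  Conversely, extensibility provides one choice whose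
  formal coboundary vanishes, and the class can be computed from it.

  What makes both directions work is that choices exist and that the class does not depend on them.

  Existence (\<open>lifting_data_exists\<close>): an invariant complement of the kernel is mapped bijectively onto
  the quotient, which gives a diagonal section (\<open>diagonal_section_exists\<close>).  A section \<open>s\<close> of the
  projection to \<open>Out\<close> yields \<open>\<rho>\<close>; the error of \<open>\<rho>\<close> is inner, and a section of \<open>ad\<close> turns it into \<open>\<omega>\<close>.

  Independence (\<open>obstruction_shift\<close>): two lifts differ by \<open>ad (b x)\<close> with \<open>b\<close> linear and compatible
  with the structure maps.  Replacing \<open>\<rho> x\<close> by \<open>\<rho> x + ad (b x)\<close> forces one to replace \<open>\<omega> [x, y]\<close> by
  \<open>\<omega> [x, y] + \<rho> x (b y) - \<rho> y (b x) - b [x, y] + [b x, b y]\<close>, and this change leaves the formal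
  coboundary as it was, because all new terms cancel cyclically (\<open>formal_coboundary_gauge\<close>).  What
  is left is a difference of two maps \<open>\<omega>\<close> with the same \<open>ad\<close>, that is, a centre-valued cochain.

  The structure map of \<open>H\<close> enters the definitions of derivations and of their bracket through its
  inverse.  Evaluating derivations \<open>\<rho> (phi x)\<close> instead of \<open>\<rho> x\<close> makes all inverses disappear; the locale
  \<open>twisted_action\<close> collects the resulting identities, and both the change of lift and the comparison with the
  coboundary operator are computed from them.
\<close>

section \<open>Additive bookkeeping\<close>

context abelian_group begin

lemma add_diff_eq: "x \<in> carrier G \<Longrightarrow> y \<in> carrier G \<Longrightarrow> z \<in> carrier G \<Longrightarrow> x \<oplus> (y \<ominus> z) = (x \<oplus> y) \<ominus> z"
  by (simp add: minus_eq a_assoc)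

lemma diff_add_eq: "x \<in> carrier G \<Longrightarrow> y \<in> carrier G \<Longrightarrow> z \<in> carrier G \<Longrightarrow> (x \<ominus> y) \<oplus> z = (x \<oplus> z) \<ominus> y"
  by (simp add: minus_eq a_ac)

lemma diff_diff_add: "x \<in> carrier G \<Longrightarrow> y \<in> carrier G \<Longrightarrow> z \<in> carrier G \<Longrightarrow> (x \<ominus> y) \<ominus> z = x \<ominus> (y \<oplus> z)"
  by (simp add: minus_eq a_ac minus_add)

lemma diff_diff_eq: "x \<in> carrier G \<Longrightarrow> y \<in> carrier G \<Longrightarrow> z \<in> carrier G \<Longrightarrow> x \<ominus> (y \<ominus> z) = (x \<oplus> z) \<ominus> y"
  by (simp add: minus_eq a_ac minus_add)

lemma add_uminus: "x \<in> carrier G \<Longrightarrow> y \<in> carrier G \<Longrightarrow> x \<oplus> \<ominus> y = x \<ominus> y"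
  by (simp add: minus_eq)

lemma uminus_add: "x \<in> carrier G \<Longrightarrow> y \<in> carrier G \<Longrightarrow> \<ominus> y \<oplus> x  = x \<ominus> y"
  by (simp add: minus_eq a_ac)

lemma diff_uminus: "x \<in> carrier G \<Longrightarrow> y \<in> carrier G \<Longrightarrow> x \<ominus> (\<ominus> y) = x \<oplus> y"
  by (simp add: minus_eq)

lemma uminus_diff: "x \<in> carrier G \<Longrightarrow> y \<in> carrier G \<Longrightarrow> \<ominus> (x \<ominus> y) = y \<ominus> x"
  by (simp add: minus_eq a_ac minus_add)

lemma diff_eq_eq: "x \<in> carrier G \<Longrightarrow> y \<in> carrier G \<Longrightarrow> z \<in> carrier G \<Longrightarrow> x \<ominus> y = z \<longleftrightarrow> x = z \<oplus> y"
  by (metis a_assoc l_neg a_comm minus_eq a_inv_closed r_zero)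

lemma eq_diff_eq: "x \<in> carrier G \<Longrightarrow> y \<in> carrier G \<Longrightarrow> z \<in> carrier G \<Longrightarrow> z = x \<ominus> y \<longleftrightarrow> z \<oplus> y = x"
  using diff_eq_eq by metis

text \<open>
  These rules carry every subtrahend to the other side of an equation; sorting by \<open>a_ac\<close>
  then decides the remaining identity between sums.
\<close>

lemmas transpose_simps = add_diff_eq diff_add_eq diff_diff_add diff_diff_eq add_uminus uminus_add
  diff_uminus uminus_diff diff_eq_eq eq_diff_eq

lemma diff_add_cancel: "x \<in> carrier G \<Longrightarrow> y \<in> carrier G \<Longrightarrow> (x \<ominus> y) \<oplus> y = x"
  by (simp add: minus_eq a_assoc l_neg)

lemma diff_self: "x \<in> carrier G \<Longrightarrow> x \<ominus> x = \<zero>"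
  by (simp add: minus_eq r_neg)

lemma diff_zero: "x \<in> carrier G \<Longrightarrow> x \<ominus> \<zero> = x"
  by (simp add: minus_eq)

lemma uminus_unique: "x \<in> carrier G \<Longrightarrow> y \<in> carrier G \<Longrightarrow> x \<oplus> y = \<zero> \<Longrightarrow> x = \<ominus> y"
  by (simp add: minus_equality)

end

section \<open>Linear maps and Hom-Lie algebras\<close>

lemma linear_map_closed: "linear_map K V W f \<Longrightarrow> x \<in> carrier V \<Longrightarrow> f x \<in> carrier W"
  unfolding linear_map_def by auto

lemma linear_map_add:
  "linear_map K V W f \<Longrightarrow> x \<in> carrier V \<Longrightarrow> y \<in> carrier V \<Longrightarrow> f (x \<oplus>\<^bsub>V\<^esub> y) = f x \<oplus>\<^bsub>W\<^esub> f y"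
  unfolding linear_map_def by auto

lemma linear_map_smult:
  "linear_map K V W f \<Longrightarrow> a \<in> carrier K \<Longrightarrow> x \<in> carrier V \<Longrightarrow> f (a \<odot>\<^bsub>V\<^esub> x) = a \<odot>\<^bsub>W\<^esub> f x"
  unfolding linear_map_def by auto

lemma linear_map_comp:
  "linear_map K U V f \<Longrightarrow> linear_map K V W g \<Longrightarrow> linear_map K U W (\<lambda>x. g (f x))"
  by (simp add: linear_map_def Pi_iff)

lemma linear_map_zero:
  assumes "linear_map K V W f" "abelian_group V" "abelian_group W"
  shows "f \<zero>\<^bsub>V\<^esub> = \<zero>\<^bsub>W\<^esub>"
proof -
  interpret V: abelian_group V by fact
  interpret W: abelian_group W by fact
  have c: "f \<zero>\<^bsub>V\<^esub> \<in> carrier W" using assms(1) by (simp add: linear_map_closed)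
  have "f \<zero>\<^bsub>V\<^esub> \<oplus>\<^bsub>W\<^esub> f \<zero>\<^bsub>V\<^esub> = f \<zero>\<^bsub>V\<^esub>"
    using linear_map_add[OF assms(1), of "\<zero>\<^bsub>V\<^esub>" "\<zero>\<^bsub>V\<^esub>"] by simp
  then show ?thesis using c by simp
qed

lemma linear_map_diff:
  assumes "linear_map K V W f" "abelian_group V" "abelian_group W" "x \<in> carrier V" "y \<in> carrier V"
  shows "f (x \<ominus>\<^bsub>V\<^esub> y) = f x \<ominus>\<^bsub>W\<^esub> f y"
proof -
  interpret V: abelian_group V by fact
  interpret W: abelian_group W by fact
  have "f (x \<ominus>\<^bsub>V\<^esub> y) \<oplus>\<^bsub>W\<^esub> f y = f x"
    using linear_map_add[OF assms(1), of "x \<ominus>\<^bsub>V\<^esub> y" y] assms(4,5) by (simp add: V.diff_add_cancel)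
  then show ?thesis using assms(4,5) linear_map_closed[OF assms(1)]
    by (simp add: W.eq_diff_eq)
qed

lemma linear_map_uminus:
  assumes "linear_map K V W f" "abelian_group V" "abelian_group W" "x \<in> carrier V"
  shows "f (\<ominus>\<^bsub>V\<^esub> x) = \<ominus>\<^bsub>W\<^esub> f x"
proof -
  interpret V: abelian_group V by fact
  interpret W: abelian_group W by fact
  have "f (\<ominus>\<^bsub>V\<^esub> x) \<oplus>\<^bsub>W\<^esub> f x = \<zero>\<^bsub>W\<^esub>"
    using linear_map_add[OF assms(1), of "\<ominus>\<^bsub>V\<^esub> x" x] assms(4) linear_map_zero[OF assms(1-3)]
    by (simp add: V.l_neg)
  then show ?thesis using assms(4) linear_map_closed[OF assms(1)]
    by (simp add: W.uminus_unique)
qed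

lemma linear_map_pointwise_add:
  assumes "module K W" "linear_map K V W f" "linear_map K V W g"
  shows "linear_map K V W (\<lambda>x. f x \<oplus>\<^bsub>W\<^esub> g x)"
proof -
  interpret W: module K W by fact
  show ?thesis using assms(2,3)
    by (auto simp: linear_map_def Pi_iff W.M.a_ac W.smult_r_distr)
qed

lemma linear_map_pointwise_diff:
  assumes "module K W" "linear_map K V W f" "linear_map K V W g"
  shows "linear_map K V W (\<lambda>x. f x \<ominus>\<^bsub>W\<^esub> g x)"
proof -
  interpret W: module K W by fact
  show ?thesis using assms(2,3)
    by (auto simp: linear_map_def Pi_iff a_minus_def W.M.a_ac W.M.minus_add W.smult_r_distr W.smult_r_minus)
qed

lemma linear_map_cong:
  assumes "module K V" "\<And>x. x \<in> carrier V \<Longrightarrow> f x = g x"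
  shows "linear_map K V W f \<longleftrightarrow> linear_map K V W g"
proof -
  interpret V: module K V by fact
  show ?thesis using assms(2) by (simp add: linear_map_def Pi_iff)
qed

context hom_lie_algebra begin

lemma abelian_group_carrier: "abelian_group L"
  by unfold_locales

lemma module_carrier: "module K L"
  by unfold_locales

lemmas phi_closed = linear_map_closed[OF phi_linear]
  and phi_add = linear_map_add[OF phi_linear]
  and phi_diff = linear_map_diff[OF phi_linear abelian_group_carrier abelian_group_carrier]

lemma linear_map_bracket_left: "y \<in> carrier L \<Longrightarrow> linear_map K L L (\<lambda>x. x \<otimes>\<^bsub>L\<^esub> y)"
  by (simp add: linear_map_def bracket_closed bracket_add_left bracket_smult_left)

lemma linear_map_bracket_right: "x \<in> carrier L \<Longrightarrow> linear_map K L L (\<lambda>y. x \<otimes>\<^bsub>L\<^esub> y)"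
  by (simp add: linear_map_def bracket_closed bracket_add_right bracket_smult_right)

lemma bracket_diff_left: "x \<in> carrier L \<Longrightarrow> y \<in> carrier L \<Longrightarrow> z \<in> carrier L \<Longrightarrow>
   (x \<ominus>\<^bsub>L\<^esub> y) \<otimes>\<^bsub>L\<^esub> z = x \<otimes>\<^bsub>L\<^esub> z \<ominus>\<^bsub>L\<^esub> y \<otimes>\<^bsub>L\<^esub> z"
  using linear_map_diff[OF linear_map_bracket_left abelian_group_carrier abelian_group_carrier] by simp

lemma bracket_diff_right: "x \<in> carrier L \<Longrightarrow> y \<in> carrier L \<Longrightarrow> z \<in> carrier L \<Longrightarrow>
   x \<otimes>\<^bsub>L\<^esub> (y \<ominus>\<^bsub>L\<^esub> z) = x \<otimes>\<^bsub>L\<^esub> y \<ominus>\<^bsub>L\<^esub> x \<otimes>\<^bsub>L\<^esub> z"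
  using linear_map_diff[OF linear_map_bracket_right abelian_group_carrier abelian_group_carrier] by simp

text \<open>
  Skew-symmetry only says that twice this bracket vanishes; two must be invertible to conclude.
\<close>

lemma bracket_self:
  assumes "\<one>\<^bsub>K\<^esub> \<oplus>\<^bsub>K\<^esub> \<one>\<^bsub>K\<^esub> \<noteq> \<zero>\<^bsub>K\<^esub>" "x \<in> carrier L"
  shows "x \<otimes>\<^bsub>L\<^esub> x = \<zero>\<^bsub>L\<^esub>"
proof -
  let ?w = "x \<otimes>\<^bsub>L\<^esub> x" and ?two = "\<one>\<^bsub>K\<^esub> \<oplus>\<^bsub>K\<^esub> \<one>\<^bsub>K\<^esub>"
  have w: "?w \<in> carrier L" using assms by (simp add: bracket_closed)
  have "?w \<oplus>\<^bsub>L\<^esub> ?w = \<zero>\<^bsub>L\<^esub>" 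
    using bracket_skew[OF assms(2,2)] w by (metis M.r_neg)
  then have z: "?two \<odot>\<^bsub>L\<^esub> ?w = \<zero>\<^bsub>L\<^esub>" using w by (simp add: smult_l_distr)
  have u: "?two \<in> Units K" using assms by (simp add: field_Units)
  have "?w = (inv\<^bsub>K\<^esub> ?two \<otimes>\<^bsub>K\<^esub> ?two) \<odot>\<^bsub>L\<^esub> ?w" using u w by simp
  also have "\<dots> = \<zero>\<^bsub>L\<^esub>" using u w z by (simp add: smult_assoc1 del: Units_l_inv)
  finally show ?thesis .
qed

text \<open>
  The Jacobi identity read as: \<open>ad\<close> is a representation up to the twist by the structure map.
\<close>

lemma jacobi_inner:
  assumes "x \<in> carrier L" "y \<in> carrier L" "z \<in> carrier L"
  shows "phi L x \<otimes>\<^bsub>L\<^esub> (y \<otimes>\<^bsub>L\<^esub> z) \<ominus>\<^bsub>L\<^esub> phi L y \<otimes>\<^bsub>L\<^esub> (x \<otimes>\<^bsub>L\<^esub> z) = (x \<otimes>\<^bsub>L\<^esub> y) \<otimes>\<^bsub>L\<^esub> phi L z"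
proof -
  note c = assms bracket_closed phi_closed
  have "phi L y \<otimes>\<^bsub>L\<^esub> (z \<otimes>\<^bsub>L\<^esub> x) = \<ominus>\<^bsub>L\<^esub> (phi L y \<otimes>\<^bsub>L\<^esub> (x \<otimes>\<^bsub>L\<^esub> z))"
    using c bracket_skew[of z x]
      linear_map_uminus[OF linear_map_bracket_right abelian_group_carrier abelian_group_carrier, of "phi L y" "x \<otimes>\<^bsub>L\<^esub> z"] by simp
  moreover have "phi L z \<otimes>\<^bsub>L\<^esub> (x \<otimes>\<^bsub>L\<^esub> y) = \<ominus>\<^bsub>L\<^esub> ((x \<otimes>\<^bsub>L\<^esub> y) \<otimes>\<^bsub>L\<^esub> phi L z)"
    using c by (simp add: bracket_skew[of "phi L z"])
  ultimately show ?thesis using hom_jacobi[OF assms] c by (simp add: M.transpose_simps M.a_ac)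
qed

lemma jacobi_outer:
  assumes "x \<in> carrier L" "y \<in> carrier L" "z \<in> carrier L"
  shows "(x \<otimes>\<^bsub>L\<^esub> y) \<otimes>\<^bsub>L\<^esub> phi L z \<oplus>\<^bsub>L\<^esub> (y \<otimes>\<^bsub>L\<^esub> z) \<otimes>\<^bsub>L\<^esub> phi L x \<oplus>\<^bsub>L\<^esub> (z \<otimes>\<^bsub>L\<^esub> x) \<otimes>\<^bsub>L\<^esub> phi L y = \<zero>\<^bsub>L\<^esub>"
proof -
  note c = assms bracket_closed phi_closed
  have "(x \<otimes>\<^bsub>L\<^esub> y) \<otimes>\<^bsub>L\<^esub> phi L z \<oplus>\<^bsub>L\<^esub> (y \<otimes>\<^bsub>L\<^esub> z) \<otimes>\<^bsub>L\<^esub> phi L x \<oplus>\<^bsub>L\<^esub> (z \<otimes>\<^bsub>L\<^esub> x) \<otimes>\<^bsub>L\<^esub> phi L y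
     = \<ominus>\<^bsub>L\<^esub> (phi L x \<otimes>\<^bsub>L\<^esub> (y \<otimes>\<^bsub>L\<^esub> z) \<oplus>\<^bsub>L\<^esub> phi L y \<otimes>\<^bsub>L\<^esub> (z \<otimes>\<^bsub>L\<^esub> x)
           \<oplus>\<^bsub>L\<^esub> phi L z \<otimes>\<^bsub>L\<^esub> (x \<otimes>\<^bsub>L\<^esub> y))"
    using c by (simp add: bracket_skew[of "x \<otimes>\<^bsub>L\<^esub> y"] bracket_skew[of "y \<otimes>\<^bsub>L\<^esub> z"] bracket_skew[of "z \<otimes>\<^bsub>L\<^esub> x"]
       M.minus_add M.a_ac)
  then show ?thesis using hom_jacobi[OF assms] by simp
qed

end

section \<open>Alternating maps\<close>

lemma pair_tuples: "[x, y] \<in> tuples 2 L \<longleftrightarrow> x \<in> carrier L \<and> y \<in> carrier L"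
  by (auto simp: tuples_def)

lemma tuples_2E:
  assumes "xs \<in> tuples 2 L"
  obtains x y where "xs = [x, y]" "x \<in> carrier L" "y \<in> carrier L"
  using assms by (auto simp: tuples_def numeral_2_eq_2 length_Suc_conv)

lemma tuples_3E:
  assumes "xs \<in> tuples 3 L"
  obtains x y z where "xs = [x, y, z]" "x \<in> carrier L" "y \<in> carrier L" "z \<in> carrier L"
  using assms by (auto simp: tuples_def numeral_3_eq_3 length_Suc_conv)

lemma triple_tuples: "[x, y, z] \<in> tuples 3 L \<longleftrightarrow> x \<in> carrier L \<and> y \<in> carrier L \<and> z \<in> carrier L"
  by (auto simp: tuples_def)

lemma alternating_maps_2I:
  assumes ext: "f \<in> extensional (tuples 2 L)"
    and lin_left: "\<And>y. y \<in> carrier L \<Longrightarrow> linear_map K L V (\<lambda>x. f [x, y])"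
    and lin_right: "\<And>x. x \<in> carrier L \<Longrightarrow> linear_map K L V (\<lambda>y. f [x, y])"
    and diag: "\<And>x. x \<in> carrier L \<Longrightarrow> f [x, x] = \<zero>\<^bsub>V\<^esub>"
  shows "f \<in> alternating_maps K 2 L V"
  unfolding alternating_maps_def
proof (intro CollectI conjI ballI allI impI)
  show "f \<in> tuples 2 L \<rightarrow>\<^sub>E carrier V"
    using ext linear_map_closed[OF lin_left] by (auto simp: PiE_def elim: tuples_2E)
next
  fix xs i y z assume xs: "xs \<in> tuples 2 L" and "i < (2::nat)" and "y \<in> carrier L" "z \<in> carrier L"
  then show "f (xs[i := y \<oplus>\<^bsub>L\<^esub> z]) = f (xs[i := y]) \<oplus>\<^bsub>V\<^esub> f (xs[i := z])"
    using linear_map_add[OF lin_left] linear_map_add[OF lin_right]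
    by (auto elim!: tuples_2E simp: less_2_cases_iff)
next
  fix xs i a y assume xs: "xs \<in> tuples 2 L" and "i < (2::nat)" and "a \<in> carrier K" "y \<in> carrier L"
  then show "f (xs[i := a \<odot>\<^bsub>L\<^esub> y]) = a \<odot>\<^bsub>V\<^esub> f (xs[i := y])"
    using linear_map_smult[OF lin_left] linear_map_smult[OF lin_right]
    by (auto elim!: tuples_2E simp: less_2_cases_iff)
next
  fix xs and i j :: nat assume "xs \<in> tuples 2 L" "i < j" "j < 2" "xs ! i = xs ! j"
  moreover have "i = 0" "j = 1" using calculation by auto
  ultimately show "f xs = \<zero>\<^bsub>V\<^esub>" using diag by (auto elim!: tuples_2E)
qed

lemma alternating_maps_2_linear_left:
  assumes "f \<in> alternating_maps K 2 L V" "y \<in> carrier L"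
  shows "linear_map K L V (\<lambda>x. f [x, y])"
proof -
  have f: "f \<in> tuples 2 L \<rightarrow> carrier V"
    "\<And>xs i y z. xs\<in>tuples 2 L \<Longrightarrow> i<2 \<Longrightarrow> y\<in>carrier L \<Longrightarrow> z\<in>carrier L \<Longrightarrow>
           f (xs[i := y \<oplus>\<^bsub>L\<^esub> z]) = f (xs[i := y]) \<oplus>\<^bsub>V\<^esub> f (xs[i := z])"
    "\<And>xs i a y. xs\<in>tuples 2 L \<Longrightarrow> i<2 \<Longrightarrow> a\<in>carrier K \<Longrightarrow> y\<in>carrier L \<Longrightarrow>
           f (xs[i := a \<odot>\<^bsub>L\<^esub> y]) = a \<odot>\<^bsub>V\<^esub> f (xs[i := y])"
    using assms(1) unfolding alternating_maps_def by auto
  show ?thesis unfolding linear_map_def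
    using assms(2) f(1) f(2)[of "[y, y]" 0] f(3)[of "[y, y]" 0]
    by (auto simp: pair_tuples Pi_iff)
qed

lemma alternating_maps_2_linear_right:
  assumes "f \<in> alternating_maps K 2 L V" "x \<in> carrier L"
  shows "linear_map K L V (\<lambda>y. f [x, y])"
proof -
  have f: "f \<in> tuples 2 L \<rightarrow> carrier V"
    "\<And>xs i y z. xs\<in>tuples 2 L \<Longrightarrow> i<2 \<Longrightarrow> y\<in>carrier L \<Longrightarrow> z\<in>carrier L \<Longrightarrow>
           f (xs[i := y \<oplus>\<^bsub>L\<^esub> z]) = f (xs[i := y]) \<oplus>\<^bsub>V\<^esub> f (xs[i := z])"
    "\<And>xs i a y. xs\<in>tuples 2 L \<Longrightarrow> i<2 \<Longrightarrow> a\<in>carrier K \<Longrightarrow> y\<in>carrier L \<Longrightarrow>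
           f (xs[i := a \<odot>\<^bsub>L\<^esub> y]) = a \<odot>\<^bsub>V\<^esub> f (xs[i := y])"
    using assms(1) unfolding alternating_maps_def by auto
  show ?thesis unfolding linear_map_def
    using assms(2) f(1) f(2)[of "[x, x]" 1] f(3)[of "[x, x]" 1]
    by (auto simp: pair_tuples Pi_iff)
qed

lemma alternating_maps_2_self:
  assumes "f \<in> alternating_maps K 2 L V" "x \<in> carrier L"
  shows "f [x, x] = \<zero>\<^bsub>V\<^esub>"
proof -
  have "\<forall>xs\<in>tuples 2 L. \<forall>i j. i < j \<longrightarrow> j < 2 \<longrightarrow> xs ! i = xs ! j \<longrightarrow> f xs = \<zero>\<^bsub>V\<^esub>"
    using assms(1) unfolding alternating_maps_def by auto
  from this[rule_format, of "[x,x]" 0 1] show ?thesis using assms(2) by (simp add: pair_tuples)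
qed

lemma alternating_maps_2_skew:
  assumes "f \<in> alternating_maps K 2 L V" "abelian_group V" "abelian_group L"
    "x \<in> carrier L" "y \<in> carrier L"
  shows "f [x, y] = \<ominus>\<^bsub>V\<^esub> f [y, x]"
proof -
  interpret V: abelian_group V by fact
  interpret L: abelian_group L by fact
  note l = linear_map_add[OF alternating_maps_2_linear_left[OF assms(1)]]
  note r = linear_map_add[OF alternating_maps_2_linear_right[OF assms(1)]]
  note c = linear_map_closed[OF alternating_maps_2_linear_right[OF assms(1)]]
  have "f [x \<oplus>\<^bsub>L\<^esub> y, x \<oplus>\<^bsub>L\<^esub> y] = \<zero>\<^bsub>V\<^esub>" using alternating_maps_2_self[OF assms(1)] assms(4,5) by simp
  moreover have "f [x \<oplus>\<^bsub>L\<^esub> y, x \<oplus>\<^bsub>L\<^esub> y]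
      = (f [x, x] \<oplus>\<^bsub>V\<^esub> f [y, x]) \<oplus>\<^bsub>V\<^esub> (f [x, y] \<oplus>\<^bsub>V\<^esub> f [y, y])"
    using assms(4,5) by (simp add: l r)
  ultimately have "f [x, y] \<oplus>\<^bsub>V\<^esub> f [y, x] = \<zero>\<^bsub>V\<^esub>"
    using assms(4,5) c by (simp add: alternating_maps_2_self[OF assms(1)] V.a_comm)
  then show ?thesis using c assms(4,5) by (simp add: V.uminus_unique)
qed

lemma alternating_maps_2_add:
  assumes "module K L" "module K V" "f \<in> alternating_maps K 2 L V" "g \<in> alternating_maps K 2 L V"
  shows "(\<lambda>xs\<in>tuples 2 L. f xs \<oplus>\<^bsub>V\<^esub> g xs) \<in> alternating_maps K 2 L V"
proof (rule alternating_maps_2I, goal_cases)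
  interpret V: module K V by fact
  note l = alternating_maps_2_linear_left and r = alternating_maps_2_linear_right
  case 1 show ?case by simp
  case (2 y) show ?case
    using linear_map_pointwise_add[OF assms(2) l[OF assms(3) 2] l[OF assms(4) 2]] 2
    by (subst linear_map_cong[OF assms(1)]) (auto simp: pair_tuples)
  case (3 x) show ?case
    using linear_map_pointwise_add[OF assms(2) r[OF assms(3) 3] r[OF assms(4) 3]] 3
    by (subst linear_map_cong[OF assms(1)]) (auto simp: pair_tuples)
  case (4 x) then show ?case
    by (simp add: pair_tuples alternating_maps_2_self[OF assms(3)] alternating_maps_2_self[OF assms(4)])
qed

lemma alternating_maps_2_diff:
  assumes "module K L" "module K V" "f \<in> alternating_maps K 2 L V" "g \<in> alternating_maps K 2 L V"
  shows "(\<lambda>xs\<in>tuples 2 L. f xs \<ominus>\<^bsub>V\<^esub> g xs) \<in> alternating_maps K 2 L V"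
proof (rule alternating_maps_2I, goal_cases)
  interpret V: module K V by fact
  note l = alternating_maps_2_linear_left and r = alternating_maps_2_linear_right
  case 1 show ?case by simp
  case (2 y) show ?case
    using linear_map_pointwise_diff[OF assms(2) l[OF assms(3) 2] l[OF assms(4) 2]] 2
    by (subst linear_map_cong[OF assms(1)]) (auto simp: pair_tuples)
  case (3 x) show ?case
    using linear_map_pointwise_diff[OF assms(2) r[OF assms(3) 3] r[OF assms(4) 3]] 3
    by (subst linear_map_cong[OF assms(1)]) (auto simp: pair_tuples)
  case (4 x) then show ?case
    by (simp add: pair_tuples alternating_maps_2_self[OF assms(3)] alternating_maps_2_self[OF assms(4)]
      V.M.diff_self)
qed

section \<open>Diagonal sections\<close>

text \<open>
  The projection is bijective on an invariant complement of its kernel, and the section is the inverse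
  of this bijection.  It is linear because the complement is a submodule, and it commutes with the
  structure maps because the complement is invariant.
\<close>

lemma diagonal_section_exists:
  assumes "diagonal_extension K H i E p G"
  shows "\<exists>s. diagonal_section K E p G s"
proof -
  have ext: "extension K H i E p G" using assms by (simp add: diagonal_extension_def)
  obtain W where W: "submodule W K E" "phi E ` W \<subseteq> W"
      "i ` carrier H \<inter> W = {\<zero>\<^bsub>E\<^esub>}" "i ` carrier H <+>\<^bsub>E\<^esub> W = carrier E"
    using assms by (auto simp: diagonal_extension_def)
  interpret E: regular_hom_lie_algebra K E using ext by (simp add: extension_def)
  interpret G: regular_hom_lie_algebra K G using ext by (simp add: extension_def)
  interpret W: submodule W K E by fact
  have p: "linear_map K E G p" and pphi: "\<And>x. x \<in> carrier E \<Longrightarrow> p (phi E x) = phi G (p x)"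
    and ker: "i ` carrier H = a_kernel E G p" and surj: "p ` carrier E = carrier G"
    using ext by (auto simp: extension_def hom_lie_morphism_def)
  have ker': "\<And>x. x \<in> i ` carrier H \<longleftrightarrow> x \<in> carrier E \<and> p x = \<zero>\<^bsub>G\<^esub>"
    unfolding ker by (auto simp: a_kernel_def')
  have WE: "\<And>w. w \<in> W \<Longrightarrow> w \<in> carrier E" using W.subset by auto
  have Wadd: "\<And>w v. w \<in> W \<Longrightarrow> v \<in> W \<Longrightarrow> w \<oplus>\<^bsub>E\<^esub> v \<in> W" using W.m_closed by auto
  have Wuminus: "\<And>w. w \<in> W \<Longrightarrow> \<ominus>\<^bsub>E\<^esub> w \<in> W" using W.m_inv_closed by (simp add: a_inv_def)
  have ex: "\<exists>w\<in>W. p w = x" if "x \<in> carrier G" for x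
  proof -
    have "x \<in> p ` carrier E" using that by (simp add: surj)
    then obtain e where e: "e \<in> carrier E" "p e = x" by blast
    then have "e \<in> i ` carrier H <+>\<^bsub>E\<^esub> W" by (simp add: W(4))
    then obtain k w where kw: "k \<in> i ` carrier H" "w \<in> W" "e = k \<oplus>\<^bsub>E\<^esub> w"
      by (auto simp: set_add_def')
    have "x = p w"
      using e kw ker' WE linear_map_add[OF p] linear_map_closed[OF p] by auto
    then show ?thesis using kw by auto
  qed
  have inj: "w = v" if "w \<in> W" "v \<in> W" "p w = p v" for w v
  proof -
    have "w \<ominus>\<^bsub>E\<^esub> v \<in> W" using that Wadd Wuminus by (simp add: a_minus_def)
    moreover have "p (w \<ominus>\<^bsub>E\<^esub> v) = \<zero>\<^bsub>G\<^esub>"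
      using that WE linear_map_closed[OF p]
        linear_map_diff[OF p E.abelian_group_carrier G.abelian_group_carrier] by (simp add: G.M.diff_self)
    ultimately have "w \<ominus>\<^bsub>E\<^esub> v = \<zero>\<^bsub>E\<^esub>" using W(3) ker' WE by blast
    then show ?thesis using that WE by (simp add: E.M.diff_eq_eq)
  qed
  define s where "s = (\<lambda>x. THE w. w \<in> W \<and> p w = x)"
  have s: "s x \<in> W \<and> p (s x) = x" if "x \<in> carrier G" for x
  proof -
    have "\<exists>!w. w \<in> W \<and> p w = x" using ex[OF that] inj by blast
    then show ?thesis unfolding s_def by (rule theI')
  qed
  have "diagonal_section K E p G s"
    unfolding diagonal_section_def linear_map_def
  proof (intro conjI ballI funcsetI)
    fix x assume x: "x \<in> carrier G"
    show "s x \<in> carrier E" "p (s x) = x" using s[OF x] WE by auto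
    show "phi E (s x) = s (phi G x)"
      using W(2) s[OF x] s[OF G.phi_closed[OF x]] WE pphi by (intro inj) auto
    fix y assume y: "y \<in> carrier G"
    show "s (x \<oplus>\<^bsub>G\<^esub> y) = s x \<oplus>\<^bsub>E\<^esub> s y"
      using s[OF x] s[OF y] s[of "x \<oplus>\<^bsub>G\<^esub> y"] x y WE linear_map_add[OF p] Wadd by (intro inj) auto
  next
    fix a x assume a: "a \<in> carrier K" and x: "x \<in> carrier G"
    show "s (a \<odot>\<^bsub>G\<^esub> x) = a \<odot>\<^bsub>E\<^esub> s x"
      using s[OF x] s[of "a \<odot>\<^bsub>G\<^esub> x"] a x WE linear_map_smult[OF p] W.smult_closed by (intro inj) auto
  qed
  then show ?thesis by blast
qed

section \<open>Twisted actions and change of lift\<close>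

text \<open>
  The properties that a lift \<open>\<rho>\<close> of an outer action has together with its error term \<open>\<omega>\<close>.  The derivation
  rule is stated at \<open>phi G x\<close> and the equation \<open>[\<rho> x, \<rho> y] - \<rho> [x, y] = ad (\<omega> [x, y])\<close> is evaluated at
  \<open>phi H u\<close>: at these arguments the inverse of the structure map cancels.
\<close>

locale twisted_action = G: regular_hom_lie_algebra K G + H: regular_hom_lie_algebra K H
  for K :: "('k, 'r) ring_scheme" and G :: "('k, 'a, 'm) hom_lie_scheme"
    and H :: "('k, 'b, 'n) hom_lie_scheme" +
  fixes \<rho> :: "'a \<Rightarrow> 'b \<Rightarrow> 'b" and \<omega> :: "'a list \<Rightarrow> 'b"
  assumes char_ne_2: "\<one>\<^bsub>K\<^esub> \<oplus>\<^bsub>K\<^esub> \<one>\<^bsub>K\<^esub> \<noteq> \<zero>\<^bsub>K\<^esub>"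
    and rho_linear: "x \<in> carrier G \<Longrightarrow> linear_map K H H (\<rho> x)"
    and rho_linear_index: "u \<in> carrier H \<Longrightarrow> linear_map K G H (\<lambda>x. \<rho> x u)"
    and rho_phi: "x \<in> carrier G \<Longrightarrow> u \<in> carrier H \<Longrightarrow> \<rho> (phi G x) (phi H u) = phi H (\<rho> x u)"
    and rho_bracket: "x \<in> carrier G \<Longrightarrow> u \<in> carrier H \<Longrightarrow> v \<in> carrier H \<Longrightarrow>
       \<rho> (phi G x) (u \<otimes>\<^bsub>H\<^esub> v) = phi H u \<otimes>\<^bsub>H\<^esub> \<rho> x v \<oplus>\<^bsub>H\<^esub> \<rho> x u \<otimes>\<^bsub>H\<^esub> phi H v"
    and omega_alternating: "\<omega> \<in> alternating_maps K 2 G H"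
    and omega_phi: "x \<in> carrier G \<Longrightarrow> y \<in> carrier G \<Longrightarrow> phi H (\<omega> [x, y]) = \<omega> [phi G x, phi G y]"
    and curvature: "x \<in> carrier G \<Longrightarrow> y \<in> carrier G \<Longrightarrow> u \<in> carrier H \<Longrightarrow>
       \<rho> (phi G x) (\<rho> y u) \<ominus>\<^bsub>H\<^esub> \<rho> (phi G y) (\<rho> x u) \<ominus>\<^bsub>H\<^esub> \<rho> (x \<otimes>\<^bsub>G\<^esub> y) (phi H u)
         = \<omega> [x, y] \<otimes>\<^bsub>H\<^esub> phi H u"
begin

lemmas rho_closed = linear_map_closed[OF rho_linear]
  and rho_add = linear_map_add[OF rho_linear]
  and rho_smult = linear_map_smult[OF rho_linear]
  and rho_diff = linear_map_diff[OF rho_linear H.abelian_group_carrier H.abelian_group_carrier]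
  and rho_add_index = linear_map_add[OF rho_linear_index]
  and rho_smult_index = linear_map_smult[OF rho_linear_index]

lemma omega_closed: "x \<in> carrier G \<Longrightarrow> y \<in> carrier G \<Longrightarrow> \<omega> [x, y] \<in> carrier H"
  using linear_map_closed[OF alternating_maps_2_linear_right[OF omega_alternating]] .

end

text \<open>
  Differences of cyclic shifts cancel in a cyclic sum; \<open>m\<close> is shifted forwards and \<open>n\<close> backwards, the
  two patterns that occur when the lift is changed.
\<close>

lemma (in abelian_group) telescope_cyclic:
  assumes "t1 \<in> carrier G" "t2 \<in> carrier G" "t3 \<in> carrier G"
    "m1 \<in> carrier G" "m2 \<in> carrier G" "m3 \<in> carrier G"
    "n1 \<in> carrier G" "n2 \<in> carrier G" "n3 \<in> carrier G"
    "d1 \<in> carrier G" "d2 \<in> carrier G" "d3 \<in> carrier G"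
    and "d1 \<oplus> d2 \<oplus> d3 = \<zero>"
  shows "(t1 \<oplus> (m2 \<ominus> m1) \<oplus> (n3 \<ominus> n1) \<oplus> d1) \<oplus> (t2 \<oplus> (m3 \<ominus> m2) \<oplus> (n1 \<ominus> n2) \<oplus> d2)
     \<oplus> (t3 \<oplus> (m1 \<ominus> m3) \<oplus> (n2 \<ominus> n3) \<oplus> d3) = t1 \<oplus> t2 \<oplus> t3"
proof -
  have "(t1 \<oplus> (m2 \<ominus> m1) \<oplus> (n3 \<ominus> n1) \<oplus> d1) \<oplus> (t2 \<oplus> (m3 \<ominus> m2) \<oplus> (n1 \<ominus> n2) \<oplus> d2)
     \<oplus> (t3 \<oplus> (m1 \<ominus> m3) \<oplus> (n2 \<ominus> n3) \<oplus> d3) = t1 \<oplus> t2 \<oplus> t3 \<oplus> (d1 \<oplus> d2 \<oplus> d3)"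
    using assms(1-12) by (simp add: transpose_simps a_ac)
  then show ?thesis using assms by simp
qed

text \<open>
  Changing the lift by the inner derivations \<open>ad (b x)\<close>.
\<close>

locale gauge_change = twisted_action K G H \<rho> \<omega>
  for K :: "('k, 'r) ring_scheme" and G :: "('k, 'a, 'm) hom_lie_scheme"
    and H :: "('k, 'b, 'n) hom_lie_scheme" and \<rho> \<omega> +
  fixes b :: "'a \<Rightarrow> 'b"
  assumes b_linear: "linear_map K G H b"
    and b_phi: "x \<in> carrier G \<Longrightarrow> b (phi G x) = phi H (b x)"
begin

lemmas b_closed = linear_map_closed[OF b_linear]
  and b_add = linear_map_add[OF b_linear]
  and b_smult = linear_map_smult[OF b_linear]

definition rho' :: "'a \<Rightarrow> 'b \<Rightarrow> 'b" where
  "rho' x u = \<rho> x u \<oplus>\<^bsub>H\<^esub> b x \<otimes>\<^bsub>H\<^esub> u"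

text \<open>
  The change of \<open>\<omega>\<close> that compensates the change of the lift: a twisted coboundary of \<open>b\<close> plus the
  quadratic term \<open>[b x, b y]\<close>, as for the curvature of a connection.
\<close>

definition omega' :: "'a list \<Rightarrow> 'b" where
  "omega' = (\<lambda>xs\<in>tuples 2 G.
     \<omega> [xs ! 0, xs ! 1] \<oplus>\<^bsub>H\<^esub> (\<rho> (xs ! 0) (b (xs ! 1)) \<ominus>\<^bsub>H\<^esub> \<rho> (xs ! 1) (b (xs ! 0)))
       \<ominus>\<^bsub>H\<^esub> b (xs ! 0 \<otimes>\<^bsub>G\<^esub> xs ! 1) \<oplus>\<^bsub>H\<^esub> b (xs ! 0) \<otimes>\<^bsub>H\<^esub> b (xs ! 1))"

lemma omega'_pair: "x \<in> carrier G \<Longrightarrow> y \<in> carrier G \<Longrightarrow>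
   omega' [x, y] = \<omega> [x, y] \<oplus>\<^bsub>H\<^esub> (\<rho> x (b y) \<ominus>\<^bsub>H\<^esub> \<rho> y (b x)) \<ominus>\<^bsub>H\<^esub> b (x \<otimes>\<^bsub>G\<^esub> y) \<oplus>\<^bsub>H\<^esub> b x \<otimes>\<^bsub>H\<^esub> b y"
  by (simp add: omega'_def pair_tuples)

lemmas closed_simps = rho_closed omega_closed b_closed
  G.bracket_closed H.bracket_closed G.phi_closed H.phi_closed

lemma omega'_closed: "x \<in> carrier G \<Longrightarrow> y \<in> carrier G \<Longrightarrow> omega' [x, y] \<in> carrier H"
  by (simp add: omega'_pair closed_simps)

lemma curvature_unfolded:
  assumes "x \<in> carrier G" "y \<in> carrier G" "u \<in> carrier H"
  shows "\<rho> (phi G x) (\<rho> y u) = \<omega> [x, y] \<otimes>\<^bsub>H\<^esub> phi H u \<oplus>\<^bsub>H\<^esub> \<rho> (x \<otimes>\<^bsub>G\<^esub> y) (phi H u) \<oplus>\<^bsub>H\<^esub> \<rho> (phi G y) (\<rho> x u)"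
  using curvature[OF assms] assms by (simp add: H.M.transpose_simps closed_simps H.M.a_ac)

text \<open>
  When the left side is expanded, the derivation rule turns the mixed terms with one \<open>\<rho>\<close> and one \<open>b\<close> into
  brackets with \<open>\<rho> x (b y)\<close> and \<open>\<rho> y (b x)\<close>, and the Jacobi identity turns the terms quadratic in \<open>b\<close> into
  the bracket with \<open>[b x, b y]\<close>.
\<close>

lemma rho'_curvature:
  assumes "x \<in> carrier G" "y \<in> carrier G" "u \<in> carrier H"
  shows "rho' (phi G x) (rho' y u) \<ominus>\<^bsub>H\<^esub> rho' (phi G y) (rho' x u) \<ominus>\<^bsub>H\<^esub> rho' (x \<otimes>\<^bsub>G\<^esub> y) (phi H u)
         = omega' [x, y] \<otimes>\<^bsub>H\<^esub> phi H u"
proof -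
  note c = assms closed_simps
  have j: "phi H (b x) \<otimes>\<^bsub>H\<^esub> (b y \<otimes>\<^bsub>H\<^esub> u)
     = (b x \<otimes>\<^bsub>H\<^esub> b y) \<otimes>\<^bsub>H\<^esub> phi H u \<oplus>\<^bsub>H\<^esub> phi H (b y) \<otimes>\<^bsub>H\<^esub> (b x \<otimes>\<^bsub>H\<^esub> u)"
    using H.jacobi_inner[of "b x" "b y" u] c by (simp add: H.M.diff_eq_eq)
  show ?thesis
    using c by (simp add: rho'_def omega'_pair b_phi rho_add rho_bracket H.bracket_add_right
      H.bracket_add_left H.bracket_diff_left curvature_unfolded[of x y] j H.M.transpose_simps H.M.a_ac)
qed

text \<open>
  Each of the three cyclic summands changes by cyclic differences of two expressions \<open>m\<close> and \<open>n\<close> and by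
  Jacobi terms \<open>d\<close>, all of which cancel in the cyclic sum.  To reach this form, the curvature equation
  exchanges the two derivations in \<open>\<rho> (phi G x) (\<rho> y (b z))\<close>; the bracket of \<open>\<omega> [x, y]\<close> with \<open>b z\<close> that it
  produces is the cyclic shift of the bracket of \<open>b x\<close> with \<open>\<omega> [y, z]\<close>.
\<close>

lemma formal_coboundary_gauge:
  assumes "x \<in> carrier G" "y \<in> carrier G" "z \<in> carrier G"
  shows "formal_coboundary G H rho' omega' x y z = formal_coboundary G H \<rho> \<omega> x y z"
proof -
  define t where "t x y z = \<rho> (phi G x) (\<omega> [y, z]) \<ominus>\<^bsub>H\<^esub> \<omega> [x \<otimes>\<^bsub>G\<^esub> y, phi G z]" for x y z
  define t' where "t' x y z = rho' (phi G x) (omega' [y, z]) \<ominus>\<^bsub>H\<^esub> omega' [x \<otimes>\<^bsub>G\<^esub> y, phi G z]" for x y z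
  define m where "m x y z = \<rho> (phi G x) (\<rho> z (b y)) \<oplus>\<^bsub>H\<^esub> phi H (b x) \<otimes>\<^bsub>H\<^esub> \<rho> z (b y)" for x y z
  define n where "n x y z = \<rho> (phi G x) (b (y \<otimes>\<^bsub>G\<^esub> z)) \<oplus>\<^bsub>H\<^esub> phi H (b x) \<otimes>\<^bsub>H\<^esub> b (y \<otimes>\<^bsub>G\<^esub> z)
     \<ominus>\<^bsub>H\<^esub> phi H (b x) \<otimes>\<^bsub>H\<^esub> \<rho> y (b z) \<ominus>\<^bsub>H\<^esub> phi H (b x) \<otimes>\<^bsub>H\<^esub> \<omega> [y, z]" for x y z
  define d where "d x y z = phi H (b x) \<otimes>\<^bsub>H\<^esub> (b y \<otimes>\<^bsub>H\<^esub> b z) \<oplus>\<^bsub>H\<^esub> b ((x \<otimes>\<^bsub>G\<^esub> y) \<otimes>\<^bsub>G\<^esub> phi G z)" for x y z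
  have key: "t' x y z = t x y z \<oplus>\<^bsub>H\<^esub> (m y z x \<ominus>\<^bsub>H\<^esub> m x y z) \<oplus>\<^bsub>H\<^esub> (n z x y \<ominus>\<^bsub>H\<^esub> n x y z) \<oplus>\<^bsub>H\<^esub> d x y z"
    if "x \<in> carrier G" "y \<in> carrier G" "z \<in> carrier G" for x y z
  proof -
    note c = that closed_simps
    \<comment> \<open>Brackets are turned so that \<open>phi H (b _)\<close> stands on the left, as in \<open>m\<close> and \<open>n\<close>.\<close>
    have s: "\<omega> [x, y] \<otimes>\<^bsub>H\<^esub> phi H (b z) = \<ominus>\<^bsub>H\<^esub> (phi H (b z) \<otimes>\<^bsub>H\<^esub> \<omega> [x, y])"
      "\<rho> x (b y) \<otimes>\<^bsub>H\<^esub> phi H (b z) = \<ominus>\<^bsub>H\<^esub> (phi H (b z) \<otimes>\<^bsub>H\<^esub> \<rho> x (b y))"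
      "b (x \<otimes>\<^bsub>G\<^esub> y) \<otimes>\<^bsub>H\<^esub> phi H (b z) = \<ominus>\<^bsub>H\<^esub> (phi H (b z) \<otimes>\<^bsub>H\<^esub> b (x \<otimes>\<^bsub>G\<^esub> y))"
      using c by (simp_all add: H.bracket_skew[of _ "phi H (b z)"])
    show ?thesis
      unfolding t'_def t_def m_def n_def d_def
      using c by (simp add: rho'_def omega'_pair b_phi rho_add rho_diff rho_bracket H.bracket_add_right
        H.bracket_diff_right curvature_unfolded[of x y] s H.M.transpose_simps H.M.a_ac)
  qed
  have "d x y z \<oplus>\<^bsub>H\<^esub> d y z x \<oplus>\<^bsub>H\<^esub> d z x y = \<zero>\<^bsub>H\<^esub>"
  proof -
    note c = assms closed_simps
    have 1: "phi H (b x) \<otimes>\<^bsub>H\<^esub> (b y \<otimes>\<^bsub>H\<^esub> b z) \<oplus>\<^bsub>H\<^esub> phi H (b y) \<otimes>\<^bsub>H\<^esub> (b z \<otimes>\<^bsub>H\<^esub> b x)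
       \<oplus>\<^bsub>H\<^esub> phi H (b z) \<otimes>\<^bsub>H\<^esub> (b x \<otimes>\<^bsub>H\<^esub> b y) = \<zero>\<^bsub>H\<^esub>" (is "?j = _")
      using c by (intro H.hom_jacobi) auto
    have "b ((x \<otimes>\<^bsub>G\<^esub> y) \<otimes>\<^bsub>G\<^esub> phi G z \<oplus>\<^bsub>G\<^esub> (y \<otimes>\<^bsub>G\<^esub> z) \<otimes>\<^bsub>G\<^esub> phi G x
        \<oplus>\<^bsub>G\<^esub> (z \<otimes>\<^bsub>G\<^esub> x) \<otimes>\<^bsub>G\<^esub> phi G y) = \<zero>\<^bsub>H\<^esub>"
      using c linear_map_zero[OF b_linear G.abelian_group_carrier H.abelian_group_carrier]
      by (simp add: G.jacobi_outer)
    then have 2: "b ((x \<otimes>\<^bsub>G\<^esub> y) \<otimes>\<^bsub>G\<^esub> phi G z) \<oplus>\<^bsub>H\<^esub> b ((y \<otimes>\<^bsub>G\<^esub> z) \<otimes>\<^bsub>G\<^esub> phi G x)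
        \<oplus>\<^bsub>H\<^esub> b ((z \<otimes>\<^bsub>G\<^esub> x) \<otimes>\<^bsub>G\<^esub> phi G y) = \<zero>\<^bsub>H\<^esub>" (is "?k = _")
      using c by (simp add: b_add)
    have "d x y z \<oplus>\<^bsub>H\<^esub> d y z x \<oplus>\<^bsub>H\<^esub> d z x y = ?j \<oplus>\<^bsub>H\<^esub> ?k"
      unfolding d_def using c by (simp add: H.M.a_ac)
    then show ?thesis by (simp add: 1 2)
  qed
  moreover have "formal_coboundary G H rho' omega' x y z = t' x y z \<oplus>\<^bsub>H\<^esub> t' y z x \<oplus>\<^bsub>H\<^esub> t' z x y"
    by (simp add: formal_coboundary_def Let_def t'_def)
  moreover have "formal_coboundary G H \<rho> \<omega> x y z = t x y z \<oplus>\<^bsub>H\<^esub> t y z x \<oplus>\<^bsub>H\<^esub> t z x y"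
    by (simp add: formal_coboundary_def Let_def t_def)
  moreover have "t x y z \<in> carrier H" "m x y z \<in> carrier H" "n x y z \<in> carrier H" "d x y z \<in> carrier H"
    if "x \<in> carrier G" "y \<in> carrier G" "z \<in> carrier G" for x y z
    using that by (simp_all add: t_def m_def n_def d_def closed_simps)
  ultimately show ?thesis
    using assms by (simp only: key H.M.telescope_cyclic)
qed

lemma omega'_phi:
  assumes "x \<in> carrier G" "y \<in> carrier G"
  shows "phi H (omega' [x, y]) = omega' [phi G x, phi G y]"
  using assms by (simp add: omega'_pair closed_simps H.phi_add H.phi_diff omega_phi rho_phi b_phi H.phi_bracket
    flip: G.phi_bracket)

lemma omega'_alternating: "omega' \<in> alternating_maps K 2 G H"
proof (rule alternating_maps_2I)
  note c = closed_simps
  note l = alternating_maps_2_linear_left[OF omega_alternating]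
  note r = alternating_maps_2_linear_right[OF omega_alternating]
  note ladd = linear_map_add[OF l] linear_map_add[OF r]
  note lsmult = linear_map_smult[OF l] linear_map_smult[OF r]
  have sd: "a \<odot>\<^bsub>H\<^esub> (u \<ominus>\<^bsub>H\<^esub> v) = a \<odot>\<^bsub>H\<^esub> u \<ominus>\<^bsub>H\<^esub> a \<odot>\<^bsub>H\<^esub> v"
    if "a \<in> carrier K" "u \<in> carrier H" "v \<in> carrier H" for a u v
    using that by (simp add: a_minus_def H.smult_r_distr H.smult_r_minus)
  show "omega' \<in> extensional (tuples 2 G)" by (simp add: omega'_def)
  show "linear_map K G H (\<lambda>x. omega' [x, y])" if "y \<in> carrier G" for y
    unfolding linear_map_def using that c
    by (auto simp: omega'_pair ladd lsmult rho_add rho_smult rho_add_index rho_smult_index b_add b_smult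
      G.bracket_add_left H.bracket_add_left G.bracket_smult_left H.bracket_smult_left
      H.smult_r_distr sd H.M.transpose_simps H.M.a_ac)
  show "linear_map K G H (\<lambda>y. omega' [x, y])" if "x \<in> carrier G" for x
    unfolding linear_map_def using that c
    by (auto simp: omega'_pair ladd lsmult rho_add rho_smult rho_add_index rho_smult_index b_add b_smult
      G.bracket_add_right H.bracket_add_right G.bracket_smult_right H.bracket_smult_right
      H.smult_r_distr sd H.M.transpose_simps H.M.a_ac)
  show "omega' [x, x] = \<zero>\<^bsub>H\<^esub>" if "x \<in> carrier G" for x
    using that c linear_map_zero[OF b_linear G.abelian_group_carrier H.abelian_group_carrier]
    by (simp add: omega'_pair alternating_maps_2_self[OF omega_alternating] G.bracket_self H.bracket_self char_ne_2
       a_minus_def H.M.r_neg)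
qed

end

section \<open>Cochains with values in the centre\<close>

lemma (in abelian_monoid) finsum_small:
  "f 0 \<in> carrier G \<Longrightarrow> f 1 \<in> carrier G \<Longrightarrow> f 2 \<in> carrier G \<Longrightarrow> finsum G f {..2::nat} = f 2 \<oplus> (f 1 \<oplus> f 0)"
  "f 0 \<in> carrier G \<Longrightarrow> f 1 \<in> carrier G \<Longrightarrow> finsum G f {..<2::nat} = f 1 \<oplus> f 0"
  "f 0 \<in> carrier G \<Longrightarrow> finsum G f {..<1::nat} = f 0"
proof -
  have s: "{..2::nat} = {2, 1, 0}" "{..<2::nat} = {1, 0}" "{..<1::nat} = {0}" by auto
  show "f 0 \<in> carrier G \<Longrightarrow> f 1 \<in> carrier G \<Longrightarrow> f 2 \<in> carrier G \<Longrightarrow> finsum G f {..2::nat} = f 2 \<oplus> (f 1 \<oplus> f 0)"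
    "f 0 \<in> carrier G \<Longrightarrow> f 1 \<in> carrier G \<Longrightarrow> finsum G f {..<2::nat} = f 1 \<oplus> f 0"
    "f 0 \<in> carrier G \<Longrightarrow> finsum G f {..<1::nat} = f 0"
    unfolding s by (simp_all add: finsum_insert Pi_iff)
qed

lemma Cen_simps [simp]:
  "carrier (Cen L) = center L" "add (Cen L) = add L" "ring.zero (Cen L) = ring.zero L"
  "smult (Cen L) = smult L" "monoid.mult (Cen L) = monoid.mult L" "phi (Cen L) = phi L"
  by (simp_all add: Cen_def)

lemma center_carrier: "u \<in> center L \<Longrightarrow> u \<in> carrier L"
  by (simp add: center_def)

lemma center_bracket: "u \<in> center L \<Longrightarrow> v \<in> carrier L \<Longrightarrow> u \<otimes>\<^bsub>L\<^esub> v = \<zero>\<^bsub>L\<^esub>"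
  by (simp add: center_def)

lemma linear_map_Cen:
  "linear_map K V (Cen L) f \<longleftrightarrow> linear_map K V L f \<and> f \<in> carrier V \<rightarrow> center L"
  by (auto simp: linear_map_def Pi_iff center_carrier)

lemma alternating_maps_Cen:
  assumes "f \<in> alternating_maps K k L (Cen H)"
  shows "f \<in> alternating_maps K k L H"
  using assms unfolding alternating_maps_def mem_Collect_eq Cen_simps
  by (simp add: PiE_iff center_carrier)

lemma alternating_maps_2_CenI:
  assumes "\<theta> \<in> alternating_maps K 2 G H"
    and "\<And>x y. x \<in> carrier G \<Longrightarrow> y \<in> carrier G \<Longrightarrow> \<theta> [x, y] \<in> center H"
  shows "\<theta> \<in> alternating_maps K 2 G (Cen H)"
proof (rule alternating_maps_2I)
  show "\<theta> \<in> extensional (tuples 2 G)"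
    using assms(1) by (auto simp: alternating_maps_def PiE_iff)
qed (use assms in \<open>auto simp: linear_map_Cen alternating_maps_2_linear_left alternating_maps_2_linear_right
    alternating_maps_2_self\<close>)

context regular_hom_lie_algebra begin

lemma phi_surj: "v \<in> carrier L \<Longrightarrow> \<exists>w\<in>carrier L. v = phi L w"
  using phi_bij by (auto simp: bij_betw_def)

text \<open>
  The structure map is surjective, so it suffices to test centrality on its values.
\<close>

lemma centerI:
  assumes "u \<in> carrier L" "\<And>w. w \<in> carrier L \<Longrightarrow> u \<otimes>\<^bsub>L\<^esub> phi L w = \<zero>\<^bsub>L\<^esub>"
  shows "u \<in> center L"
  unfolding center_def using assms phi_surj by fastforce

lemma phi_center: "u \<in> center L \<Longrightarrow> phi L u \<in> center L"
  using linear_map_zero[OF phi_linear abelian_group_carrier abelian_group_carrier]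
  by (intro centerI) (auto simp: center_carrier center_bracket phi_closed simp flip: phi_bracket)

end

lemma formal_coboundary_cong:
  assumes "\<And>x u. x \<in> carrier G \<Longrightarrow> u \<in> carrier H \<Longrightarrow> \<rho> x u = \<rho>' x u"
    and "\<And>x y. x \<in> carrier G \<Longrightarrow> y \<in> carrier G \<Longrightarrow> \<omega> [x, y] \<in> carrier H"
    and "hom_lie_algebra K G"
    and "x \<in> carrier G" "y \<in> carrier G" "z \<in> carrier G"
  shows "formal_coboundary G H \<rho> \<omega> x y z = formal_coboundary G H \<rho>' \<omega> x y z"
proof -
  interpret G: hom_lie_algebra K G by fact
  show ?thesis using assms(1,2,4-6) by (simp add: formal_coboundary_def G.phi_closed)
qed

context twisted_action begin

lemma formal_coboundary_closed:
  assumes "\<theta> \<in> alternating_maps K 2 G H" "x \<in> carrier G" "y \<in> carrier G" "z \<in> carrier G"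
  shows "formal_coboundary G H \<rho> \<theta> x y z \<in> carrier H"
  using assms(2-) linear_map_closed[OF alternating_maps_2_linear_right[OF assms(1)]]
  by (simp add: formal_coboundary_def rho_closed G.phi_closed G.bracket_closed)

lemma formal_coboundary_add:
  assumes "\<theta> \<in> alternating_maps K 2 G H" "\<eta> \<in> alternating_maps K 2 G H"
    and "\<And>x y. x \<in> carrier G \<Longrightarrow> y \<in> carrier G \<Longrightarrow> \<zeta> [x, y] = \<theta> [x, y] \<oplus>\<^bsub>H\<^esub> \<eta> [x, y]"
    and "x \<in> carrier G" "y \<in> carrier G" "z \<in> carrier G"
  shows "formal_coboundary G H \<rho> \<zeta> x y z
     = formal_coboundary G H \<rho> \<theta> x y z \<oplus>\<^bsub>H\<^esub> formal_coboundary G H \<rho> \<eta> x y z"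
  using assms(3-) linear_map_closed[OF alternating_maps_2_linear_right[OF assms(1)]]
    linear_map_closed[OF alternating_maps_2_linear_right[OF assms(2)]]
  by (simp add: formal_coboundary_def rho_closed rho_add G.phi_closed G.bracket_closed H.M.transpose_simps H.M.a_ac)

text \<open>
  For central \<open>u\<close> the derivation rule applied to \<open>[u, v] = 0\<close> leaves only the term \<open>[\<rho> x u, phi H v]\<close>.
\<close>

lemma rho_center:
  assumes "x \<in> carrier G" "u \<in> center H"
  shows "\<rho> x u \<in> center H"
proof (rule H.centerI)
  note u = center_carrier[OF assms(2)]
  show "\<rho> x u \<in> carrier H" using assms u by (simp add: rho_closed)
  fix v assume v: "v \<in> carrier H"
  have "\<rho> (phi G x) (u \<otimes>\<^bsub>H\<^esub> v) = \<zero>\<^bsub>H\<^esub>"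
    using assms v linear_map_zero[OF rho_linear H.abelian_group_carrier H.abelian_group_carrier]
    by (simp add: center_bracket G.phi_closed)
  moreover have "phi H u \<otimes>\<^bsub>H\<^esub> \<rho> x v = \<zero>\<^bsub>H\<^esub>"
    using assms v by (simp add: center_bracket H.phi_center rho_closed)
  ultimately show "\<rho> x u \<otimes>\<^bsub>H\<^esub> phi H v = \<zero>\<^bsub>H\<^esub>"
    using rho_bracket[OF assms(1) u v] assms(1) u v
    by (simp add: rho_closed H.bracket_closed H.phi_closed)
qed

text \<open>
  The coboundary operator has signed summands and the formal coboundary cyclic ones; skew-symmetry of
  \<open>\<theta>\<close> and of the bracket of \<open>G\<close>, applied to the terms where \<open>y\<close> is singled out, translates between them.
\<close>

lemma coboundary_eq_formal_coboundary:
  assumes "module K (Cen H)" and \<theta>: "\<theta> \<in> alternating_maps K 2 G (Cen H)"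
    and x: "x \<in> carrier G" and y: "y \<in> carrier G" and z: "z \<in> carrier G"
  shows "coboundary K 2 G (Cen H) (\<lambda>x\<in>carrier G. \<lambda>u\<in>center H. \<rho> x u) \<theta> [x, y, z]
     = formal_coboundary G H \<rho> \<theta> x y z"
proof -
  interpret C: module K "Cen H" by fact
  note \<theta>H = alternating_maps_Cen[OF \<theta>]
  have \<theta>C: "\<theta> [x, y] \<in> center H" if "x \<in> carrier G" "y \<in> carrier G" for x y
    using linear_map_closed[OF alternating_maps_2_linear_right[OF \<theta> that(1)]] that(2) by simp
  have smC: "a \<odot>\<^bsub>H\<^esub> u \<in> center H" if "a \<in> carrier K" "u \<in> center H" for a u
    using C.smult_closed[of a u] that by simp
  have skew: "\<theta> [x, y] = \<ominus>\<^bsub>H\<^esub> \<theta> [y, x]" if "x \<in> carrier G" "y \<in> carrier G" for x y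
    using alternating_maps_2_skew[OF \<theta>H H.abelian_group_carrier G.abelian_group_carrier that] .
  have s1: "\<rho> (phi G y) (\<theta> [x, z]) = \<ominus>\<^bsub>H\<^esub> \<rho> (phi G y) (\<theta> [z, x])"
    using skew[OF x z] x y z \<theta>C
      linear_map_uminus[OF rho_linear H.abelian_group_carrier H.abelian_group_carrier, of "phi G y"]
    by (simp add: G.phi_closed center_carrier)
  have s2: "\<theta> [x \<otimes>\<^bsub>G\<^esub> z, phi G y] = \<ominus>\<^bsub>H\<^esub> \<theta> [z \<otimes>\<^bsub>G\<^esub> x, phi G y]"
    using G.bracket_skew[OF x z] x y z 
      linear_map_uminus[OF alternating_maps_2_linear_left[OF \<theta>H] G.abelian_group_carrier H.abelian_group_carrier]
    by (simp add: G.phi_closed G.bracket_closed)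
  note c = x y z \<theta>C rho_center G.phi_closed G.bracket_closed smC
  have neg: "(\<ominus>\<^bsub>K\<^esub> \<one>\<^bsub>K\<^esub>) \<odot>\<^bsub>H\<^esub> u = \<ominus>\<^bsub>H\<^esub> u" if "u \<in> carrier H" for u
    using that by (simp add: H.smult_l_minus)
  have negC: "\<ominus>\<^bsub>H\<^esub> u \<in> center H" if "u \<in> center H" for u
    using smC[OF _ that, of "\<ominus>\<^bsub>K\<^esub> \<one>\<^bsub>K\<^esub>"] that by (simp add: neg center_carrier)
  have sq: "(\<ominus>\<^bsub>K\<^esub> \<one>\<^bsub>K\<^esub>) \<otimes>\<^bsub>K\<^esub> (\<ominus>\<^bsub>K\<^esub> \<one>\<^bsub>K\<^esub>) = \<one>\<^bsub>K\<^esub>"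
    by (simp add: G.l_minus)
  have pow: "(\<ominus>\<^bsub>K\<^esub> \<one>\<^bsub>K\<^esub>) [^]\<^bsub>K\<^esub> (2::nat) = \<one>\<^bsub>K\<^esub>"
    by (simp add: numeral_2_eq_2 sq)
  let ?r = "\<lambda>x\<in>carrier G. \<lambda>u\<in>center H. \<rho> x u" and ?e = "\<ominus>\<^bsub>K\<^esub> \<one>\<^bsub>K\<^esub>"
  define F where "F = (\<lambda>i. (?e [^]\<^bsub>K\<^esub> (i::nat)) \<odot>\<^bsub>H\<^esub> ?r (phi G ([x, y, z] ! i)) (\<theta> (omit i [x, y, z])))"
  define E where "E = (\<lambda>j i. (?e [^]\<^bsub>K\<^esub> (i + j :: nat))
     \<odot>\<^bsub>H\<^esub> \<theta> (([x, y, z] ! i \<otimes>\<^bsub>G\<^esub> [x, y, z] ! j) # map (phi G) (omit i (omit j [x, y, z]))))"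
  have F: "F 0 = \<rho> (phi G x) (\<theta> [y, z])" "F 1 = \<ominus>\<^bsub>H\<^esub> \<rho> (phi G y) (\<theta> [x, z])"
      "F 2 = \<rho> (phi G z) (\<theta> [x, y])"
    and FC: "F 0 \<in> center H" "F 1 \<in> center H" "F 2 \<in> center H"
    using c by (simp_all add: F_def omit_def pow sq neg negC center_carrier)
  have E: "E 1 0 = \<ominus>\<^bsub>H\<^esub> \<theta> [x \<otimes>\<^bsub>G\<^esub> y, phi G z]" "E 2 0 = \<theta> [x \<otimes>\<^bsub>G\<^esub> z, phi G y]"
      "E 2 1 = \<ominus>\<^bsub>H\<^esub> \<theta> [y \<otimes>\<^bsub>G\<^esub> z, phi G x]"
    and EC: "E 1 0 \<in> center H" "E 2 0 \<in> center H" "E 2 1 \<in> center H"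
    using c by (simp_all add: E_def omit_def pow sq neg negC center_carrier)
  have "coboundary K 2 G (Cen H) ?r \<theta> [x, y, z]
      = finsum (Cen H) F {..2} \<oplus>\<^bsub>H\<^esub> finsum (Cen H) (\<lambda>j. finsum (Cen H) (E j) {..<j}) {..2}"
    using x y z by (simp add: coboundary_def F_def E_def tuples_def)
  also have "finsum (Cen H) F {..2} = F 2 \<oplus>\<^bsub>H\<^esub> (F 1 \<oplus>\<^bsub>H\<^esub> F 0)"
    using C.M.finsum_small(1)[of F] FC by simp
  also have "finsum (Cen H) (\<lambda>j. finsum (Cen H) (E j) {..<j}) {..2} = (E 2 1 \<oplus>\<^bsub>H\<^esub> E 2 0) \<oplus>\<^bsub>H\<^esub> E 1 0"
  proof -
    have e: "finsum (Cen H) (E 0) {..<0} = \<zero>\<^bsub>H\<^esub>" "finsum (Cen H) (E 1) {..<1} = E 1 0"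
      "finsum (Cen H) (E 2) {..<2} = E 2 1 \<oplus>\<^bsub>H\<^esub> E 2 0"
      using C.M.finsum_small(2)[of "E 2"] C.M.finsum_small(3)[of "E 1"] EC by simp_all
    have cl: "E 2 1 \<oplus>\<^bsub>H\<^esub> E 2 0 \<in> center H" "\<zero>\<^bsub>H\<^esub> \<in> center H"
      using C.M.a_closed[of "E 2 1" "E 2 0"] C.M.zero_closed EC by simp_all
    show ?thesis
      using C.M.finsum_small(1)[of "\<lambda>j. finsum (Cen H) (E j) {..<j}"] cl EC
      by (simp only: e Cen_simps H.M.r_zero center_carrier)
  qed
  also have "(F 2 \<oplus>\<^bsub>H\<^esub> (F 1 \<oplus>\<^bsub>H\<^esub> F 0)) \<oplus>\<^bsub>H\<^esub> ((E 2 1 \<oplus>\<^bsub>H\<^esub> E 2 0) \<oplus>\<^bsub>H\<^esub> E 1 0)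
     = (\<rho> (phi G z) (\<theta> [x, y]) \<oplus>\<^bsub>H\<^esub> (\<ominus>\<^bsub>H\<^esub> \<rho> (phi G y) (\<theta> [x, z]) \<oplus>\<^bsub>H\<^esub> \<rho> (phi G x) (\<theta> [y, z])))
     \<oplus>\<^bsub>H\<^esub> ((\<ominus>\<^bsub>H\<^esub> \<theta> [y \<otimes>\<^bsub>G\<^esub> z, phi G x] \<oplus>\<^bsub>H\<^esub> \<theta> [x \<otimes>\<^bsub>G\<^esub> z, phi G y]) \<oplus>\<^bsub>H\<^esub> \<ominus>\<^bsub>H\<^esub> \<theta> [x \<otimes>\<^bsub>G\<^esub> y, phi G z])"
    by (simp only: F E)
  also have "\<dots> = formal_coboundary G H \<rho> \<theta> x y z"
    unfolding s1 s2 formal_coboundary_def Let_def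
    using c by (simp add: center_carrier H.M.transpose_simps H.M.a_ac)
  finally show ?thesis .
qed

end

lemma cochains_add:
  assumes "module K (Cen H)" "hom_lie_algebra K G" "hom_lie_algebra K H"
    and "\<theta> \<in> cochains K 2 G (Cen H) (phi H)" "\<eta> \<in> cochains K 2 G (Cen H) (phi H)"
  shows "(\<lambda>xs\<in>tuples 2 G. \<theta> xs \<oplus>\<^bsub>H\<^esub> \<eta> xs) \<in> cochains K 2 G (Cen H) (phi H)"
proof -
  interpret C: module K "Cen H" by fact
  interpret G: hom_lie_algebra K G by fact
  interpret H: hom_lie_algebra K H by fact
  have a: "\<theta> \<in> alternating_maps K 2 G (Cen H)" "\<eta> \<in> alternating_maps K 2 G (Cen H)"
    and p: "\<And>xs. xs \<in> tuples 2 G \<Longrightarrow> phi H (\<theta> xs) = \<theta> (map (phi G) xs)"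
      "\<And>xs. xs \<in> tuples 2 G \<Longrightarrow> phi H (\<eta> xs) = \<eta> (map (phi G) xs)"
    using assms by (auto simp: cochains_def)
  have cl: "\<theta> [x, y] \<in> center H" "\<eta> [x, y] \<in> center H" if "x \<in> carrier G" "y \<in> carrier G" for x y
    using linear_map_closed[OF alternating_maps_2_linear_right[OF a(1) that(1)]] 
      linear_map_closed[OF alternating_maps_2_linear_right[OF a(2) that(1)]] that(2) by simp_all
  have "(\<lambda>xs\<in>tuples 2 G. \<theta> xs \<oplus>\<^bsub>H\<^esub> \<eta> xs) \<in> alternating_maps K 2 G (Cen H)"
    using alternating_maps_2_add[OF G.module_carrier assms(1) a] by simp
  moreover have "phi H ((\<lambda>xs\<in>tuples 2 G. \<theta> xs \<oplus>\<^bsub>H\<^esub> \<eta> xs) xs)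
      = (\<lambda>xs\<in>tuples 2 G. \<theta> xs \<oplus>\<^bsub>H\<^esub> \<eta> xs) (map (phi G) xs)" if "xs \<in> tuples 2 G" for xs
    using that p[OF that] cl by (auto elim!: tuples_2E simp: pair_tuples G.phi_closed H.phi_add center_carrier)
  ultimately show ?thesis by (simp add: cochains_def)
qed

section \<open>Derivations, liftings and the obstruction class\<close>

text \<open>
  The two diagonal extensions provide sections of the projection to \<open>Out\<close> and of \<open>ad\<close>; the
  hypothesis on the characteristic makes skew-symmetric brackets alternating.
\<close>

locale outer_action = G: regular_hom_lie_algebra K G + H: regular_hom_lie_algebra K H
  for K :: "('k, 'r) ring_scheme" and G :: "('k, 'a, 'm) hom_lie_scheme"
    and H :: "('k, 'b, 'n) hom_lie_scheme" +
  fixes rbar :: "'a \<Rightarrow> ('b \<Rightarrow> 'b) set"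
  assumes char_ne_2: "\<one>\<^bsub>K\<^esub> \<oplus>\<^bsub>K\<^esub> \<one>\<^bsub>K\<^esub> \<noteq> \<zero>\<^bsub>K\<^esub>"
    and Out_diagonal:
      "diagonal_extension K (Inn K H) (\<lambda>D. D) (Der K H) (out_proj K H) (Out K H)"
    and Inn_diagonal: "diagonal_extension K (Cen H) (\<lambda>u. u) H (ad H) (Inn K H)"
    and rbar_morphism: "hom_lie_morphism K G (Out K H) rbar"
begin

lemma Der_regular: "regular_hom_lie_algebra K (Der K H)"
  and Out_regular: "regular_hom_lie_algebra K (Out K H)"
  and Inn_regular: "regular_hom_lie_algebra K (Inn K H)"
  and Cen_regular: "regular_hom_lie_algebra K (Cen H)"
  and out_proj_morphism: "hom_lie_morphism K (Der K H) (Out K H) (out_proj K H)"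
  and out_proj_kernel: "carrier (Inn K H) = a_kernel (Der K H) (Out K H) (out_proj K H)"
  using Out_diagonal Inn_diagonal by (auto simp: diagonal_extension_def extension_def)

sublocale D: regular_hom_lie_algebra K "Der K H" by (rule Der_regular)
sublocale O: regular_hom_lie_algebra K "Out K H" by (rule Out_regular)
sublocale I: regular_hom_lie_algebra K "Inn K H" by (rule Inn_regular)

lemma Cen_module: "module K (Cen H)"
  using Cen_regular by (simp add: regular_hom_lie_algebra_def hom_lie_algebra_def)

lemma Inn_simps [simp]:
  "carrier (Inn K H) = ad H ` carrier H" "add (Inn K H) = add (Der K H)"
  "ring.zero (Inn K H) = ring.zero (Der K H)" "smult (Inn K H) = smult (Der K H)"
  "phi (Inn K H) = phi (Der K H)"
  by (simp_all add: Inn_def)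

lemma Der_linear: "A \<in> carrier (Der K H) \<Longrightarrow> linear_map K H H A"
  by (simp add: Der_def derivations_def hom_gl_def)

lemma Der_add: "v \<in> carrier H \<Longrightarrow> (A \<oplus>\<^bsub>Der K H\<^esub> B) v = A v \<oplus>\<^bsub>H\<^esub> B v"
  by (simp add: Der_def hom_gl_def)

lemma Der_smult: "v \<in> carrier H \<Longrightarrow> (a \<odot>\<^bsub>Der K H\<^esub> A) v = a \<odot>\<^bsub>H\<^esub> A v"
  by (simp add: Der_def hom_gl_def)

lemma Der_diff:
  assumes "A \<in> carrier (Der K H)" "B \<in> carrier (Der K H)" "v \<in> carrier H"
  shows "(A \<ominus>\<^bsub>Der K H\<^esub> B) v = A v \<ominus>\<^bsub>H\<^esub> B v"
proof -
  have "(A \<ominus>\<^bsub>Der K H\<^esub> B) v \<oplus>\<^bsub>H\<^esub> B v = A v"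
    using assms by (simp add: D.M.diff_add_cancel flip: Der_add)
  then show ?thesis
    using assms linear_map_closed[OF Der_linear] by (simp add: H.M.eq_diff_eq)
qed

lemma phi_inv: "v \<in> carrier H \<Longrightarrow> inv_into (carrier H) (phi H) (phi H v) = v"
  using H.phi_bij by (simp add: bij_betw_def)

lemma Der_phi: "v \<in> carrier H \<Longrightarrow> phi (Der K H) A (phi H v) = phi H (A v)"
  by (simp add: Der_def hom_gl_def Ad_def H.phi_closed phi_inv)

text \<open>Reading the derivation rule at \<open>phi (Der K H) A\<close> removes all inverses of the structure map.\<close>

lemma Der_phi_bracket:
  assumes A: "A \<in> carrier (Der K H)" and u: "u \<in> carrier H" and v: "v \<in> carrier H"
  shows "phi (Der K H) A (u \<otimes>\<^bsub>H\<^esub> v) = phi H u \<otimes>\<^bsub>H\<^esub> A v \<oplus>\<^bsub>H\<^esub> A u \<otimes>\<^bsub>H\<^esub> phi H v"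
proof -
  let ?i = "inv_into (carrier H) (phi H)"
  have inv2: "inv_into (carrier H) ?i w = phi H w" if "w \<in> carrier H" for w
    using inv_into_inv_into_eq[OF H.phi_bij that] .
  have B: "phi (Der K H) A \<in> derivations K H"
    using D.phi_closed[OF A] by (simp add: Der_def)
  have *: "Ad H ?i (phi (Der K H) A) w = A w" if "w \<in> carrier H" for w
    using that A linear_map_closed[OF Der_linear[OF A]]
    by (simp add: Ad_def inv2 Der_phi phi_inv)
  show ?thesis
    using B u v by (simp add: derivations_def Let_def *)
qed

text \<open>
  For the same reason the bracket is evaluated at \<open>phi H v\<close>.
\<close>

lemma Der_bracket:
  assumes A: "A \<in> carrier (Der K H)" and B: "B \<in> carrier (Der K H)" and v: "v \<in> carrier H"
  shows "(A \<otimes>\<^bsub>Der K H\<^esub> B) (phi H v) = phi (Der K H) A (B v) \<ominus>\<^bsub>H\<^esub> phi (Der K H) B (A v)"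
proof -
  let ?i = "inv_into (carrier H) (phi H)"
  have *: "phi H (C (?i w)) = phi (Der K H) C w" if "w \<in> carrier H" for C w
    using H.phi_surj[OF that] by (auto simp: phi_inv Der_phi)
  have "(A \<otimes>\<^bsub>Der K H\<^esub> B) (phi H v)
      = phi H (A (?i (B (?i (phi H v))))) \<ominus>\<^bsub>H\<^esub> phi H (B (?i (A (?i (phi H v)))))"
    using H.phi_closed[OF v] by (simp add: Der_def hom_gl_def gl_bracket_def Let_def)
  also have "\<dots> = phi H (A (?i (B v))) \<ominus>\<^bsub>H\<^esub> phi H (B (?i (A v)))"
    by (simp only: phi_inv[OF v])
  finally show ?thesis 
    using * linear_map_closed[OF Der_linear[OF A] v] linear_map_closed[OF Der_linear[OF B] v] by simp
qed

lemma out_proj_linear: "linear_map K (Der K H) (Out K H) (out_proj K H)"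
  using out_proj_morphism by (simp add: hom_lie_morphism_def)

lemma out_proj_zeroD:
  assumes "A \<in> carrier (Der K H)" "out_proj K H A = \<zero>\<^bsub>Out K H\<^esub>"
  shows "A \<in> ad H ` carrier H"
  using assms out_proj_kernel by (simp add: a_kernel_def')

lemma out_proj_eqD:
  assumes "A \<in> carrier (Der K H)" "B \<in> carrier (Der K H)" "out_proj K H A = out_proj K H B"
  shows "A \<ominus>\<^bsub>Der K H\<^esub> B \<in> ad H ` carrier H"
  using assms linear_map_closed[OF out_proj_linear]
  by (intro out_proj_zeroD)
    (simp_all add: linear_map_diff[OF out_proj_linear D.abelian_group_carrier O.abelian_group_carrier]
      O.M.diff_self)

lemma rbar_linear: "linear_map K G (Out K H) rbar"
  and rbar_bracket: "x \<in> carrier G \<Longrightarrow> y \<in> carrier G \<Longrightarrow> rbar (x \<otimes>\<^bsub>G\<^esub> y) = rbar x \<otimes>\<^bsub>Out K H\<^esub> rbar y"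
  and rbar_phi: "x \<in> carrier G \<Longrightarrow> rbar (phi G x) = phi (Out K H) (rbar x)"
  using rbar_morphism by (auto simp: hom_lie_morphism_def)

lemmas rbar_closed = linear_map_closed[OF rbar_linear]

abbreviation lift_section :: "(('b \<Rightarrow> 'b) set \<Rightarrow> 'b \<Rightarrow> 'b) \<Rightarrow> bool" where
  "lift_section \<equiv> diagonal_section K (Der K H) (out_proj K H) (Out K H)"

lemma lift_linear: "lift_section s \<Longrightarrow> linear_map K G (Der K H) (\<lambda>x. s (rbar x))"
  unfolding diagonal_section_def by (blast intro: linear_map_comp[OF rbar_linear])

lemma lift_closed: "lift_section s \<Longrightarrow> x \<in> carrier G \<Longrightarrow> s (rbar x) \<in> carrier (Der K H)"
  using linear_map_closed[OF lift_linear] by blast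

lemma lift_proj: "lift_section s \<Longrightarrow> x \<in> carrier G \<Longrightarrow> out_proj K H (s (rbar x)) = rbar x"
  using rbar_closed by (simp add: diagonal_section_def)

lemma lift_phi: "lift_section s \<Longrightarrow> x \<in> carrier G \<Longrightarrow> s (rbar (phi G x)) = phi (Der K H) (s (rbar x))"
  using rbar_closed by (simp add: diagonal_section_def rbar_phi)

lemma lift_difference:
  assumes "lift_section s" "lift_section s'" "x \<in> carrier G"
  shows "s' (rbar x) \<ominus>\<^bsub>Der K H\<^esub> s (rbar x) \<in> ad H ` carrier H"
  using assms by (simp add: out_proj_eqD lift_closed lift_proj)

text \<open>
  Two lifts differ by an inner derivation, and inner derivations kill the centre.  Hence the induced
  action on the centre depends on \<open>rbar\<close> alone.
\<close>

lemma lift_center: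
  assumes "lift_section s" "lift_section s'" "x \<in> carrier G" "u \<in> center H"
  shows "s' (rbar x) u = s (rbar x) u"
proof -
  note u = center_carrier[OF assms(4)]
  obtain w where w: "w \<in> carrier H" "s' (rbar x) \<ominus>\<^bsub>Der K H\<^esub> s (rbar x) = ad H w"
    using lift_difference[OF assms(1-3)] by blast
  have "s' (rbar x) u \<ominus>\<^bsub>H\<^esub> s (rbar x) u = w \<otimes>\<^bsub>H\<^esub> u"
    using fun_cong[OF w(2), of u] u assms by (simp add: Der_diff lift_closed ad_def)
  also have "\<dots> = \<zero>\<^bsub>H\<^esub>"
    using w(1) u assms(4) by (simp add: H.bracket_skew[of w] center_bracket)
  finally show ?thesis
    using assms u linear_map_closed[OF Der_linear[OF lift_closed]] by (simp add: H.M.diff_eq_eq)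
qed

lemma center_rep_eq:
  assumes "lift_section s"
  shows "center_rep K G H rbar = (\<lambda>x\<in>carrier G. \<lambda>u\<in>center H. s (rbar x) u)"
  unfolding center_rep_def
proof (rule the_equality)
  show "\<exists>s'. lift_section s' \<and> (\<lambda>x\<in>carrier G. \<lambda>u\<in>center H. s (rbar x) u)
      = (\<lambda>x\<in>carrier G. \<lambda>u\<in>center H. s' (rbar x) u)"
    using assms by blast
  fix r assume "\<exists>s'. lift_section s' \<and> r = (\<lambda>x\<in>carrier G. \<lambda>u\<in>center H. s' (rbar x) u)"
  then show "r = (\<lambda>x\<in>carrier G. \<lambda>u\<in>center H. s (rbar x) u)"
    using lift_center[OF assms] by (auto intro!: restrict_ext)
qed

lemma lifting_data_twisted_action:
  assumes "lifting_data K G H rbar s \<omega>"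
  shows "twisted_action K G H (\<lambda>x. s (rbar x)) \<omega>"
proof -
  have s: "lift_section s" and \<omega>: "\<omega> \<in> alternating_maps K 2 G H"
    and p: "\<And>x y. x \<in> carrier G \<Longrightarrow> y \<in> carrier G \<Longrightarrow> phi H (\<omega> [x, y]) = \<omega> [phi G x, phi G y]"
    and c: "\<And>x y. x \<in> carrier G \<Longrightarrow> y \<in> carrier G \<Longrightarrow>
       s (rbar x) \<otimes>\<^bsub>Der K H\<^esub> s (rbar y) \<ominus>\<^bsub>Der K H\<^esub> s (rbar (x \<otimes>\<^bsub>G\<^esub> y)) = ad H (\<omega> [x, y])"
    using assms by (auto simp: lifting_data_def)
  note lc = lift_closed[OF s]
  show ?thesis
  proof (unfold_locales, goal_cases)
    case 1 show ?case by (rule char_ne_2)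
  next
    case (2 x) then show ?case by (intro Der_linear lc)
  next
    case (3 u) then show ?case
      using lift_linear[OF s] linear_map_closed[OF Der_linear[OF lc]]
      by (simp add: linear_map_def Der_add Der_smult)
  next
    case (4 x u) then show ?case by (simp add: lift_phi[OF s] Der_phi)
  next
    case (5 x u v) then show ?case by (simp add: lift_phi[OF s] Der_phi_bracket lc)
  next
    case 6 show ?case by (rule \<omega>)
  next
    case (7 x y) then show ?case by (rule p)
  next
    case (8 x y u)
    have "s (rbar (phi G x)) (s (rbar y) u) \<ominus>\<^bsub>H\<^esub> s (rbar (phi G y)) (s (rbar x) u)
        \<ominus>\<^bsub>H\<^esub> s (rbar (x \<otimes>\<^bsub>G\<^esub> y)) (phi H u)
      = (s (rbar x) \<otimes>\<^bsub>Der K H\<^esub> s (rbar y) \<ominus>\<^bsub>Der K H\<^esub> s (rbar (x \<otimes>\<^bsub>G\<^esub> y))) (phi H u)"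
      using 8 by (simp add: Der_diff Der_bracket lift_phi[OF s] lc D.bracket_closed G.bracket_closed H.phi_closed)
    then show ?case using 8 by (simp add: c ad_def H.phi_closed)
  qed
qed

text \<open>
  The error \<open>\<kappa> x y\<close> of the lift is killed by the projection to \<open>Out\<close>, since \<open>rbar\<close> is a morphism; so it
  is inner, and a diagonal section \<open>t\<close> of \<open>ad\<close> provides \<open>\<omega> = t \<circ> \<kappa>\<close>.
\<close>

lemma lifting_data_exists: "\<exists>s \<omega>. lifting_data K G H rbar s \<omega>"
proof -
  obtain s where s: "lift_section s" using diagonal_section_exists[OF Out_diagonal] by blast
  obtain t where "diagonal_section K H (ad H) (Inn K H) t"
    using diagonal_section_exists[OF Inn_diagonal] by blast
  then have t: "linear_map K (Inn K H) H t" "\<And>A. A \<in> ad H ` carrier H \<Longrightarrow> ad H (t A) = A"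
    "\<And>A. A \<in> ad H ` carrier H \<Longrightarrow> phi H (t A) = t (phi (Der K H) A)"
    by (auto simp: diagonal_section_def)
  note lc = lift_closed[OF s]
  define \<kappa> where "\<kappa> x y = s (rbar x) \<otimes>\<^bsub>Der K H\<^esub> s (rbar y) \<ominus>\<^bsub>Der K H\<^esub> s (rbar (x \<otimes>\<^bsub>G\<^esub> y))" for x y
  note c = lc G.bracket_closed D.bracket_closed
  have \<kappa>: "\<kappa> x y \<in> ad H ` carrier H" if "x \<in> carrier G" "y \<in> carrier G" for x y
    using that out_proj_morphism unfolding \<kappa>_def
    by (intro out_proj_eqD) (simp_all add: c lift_proj[OF s] hom_lie_morphism_def flip: rbar_bracket)
  have "linear_map K G (Der K H) (\<lambda>x. \<kappa> x y)" "linear_map K G (Der K H) (\<lambda>x. \<kappa> y x)"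
    if y: "y \<in> carrier G" for y
    using linear_map_pointwise_diff[OF D.module_carrier
        linear_map_comp[OF lift_linear[OF s] D.linear_map_bracket_left[OF lc[OF y]]]
        linear_map_comp[OF G.linear_map_bracket_left[OF y] lift_linear[OF s]]]
      linear_map_pointwise_diff[OF D.module_carrier
        linear_map_comp[OF lift_linear[OF s] D.linear_map_bracket_right[OF lc[OF y]]]
        linear_map_comp[OF G.linear_map_bracket_right[OF y] lift_linear[OF s]]]
    by (simp_all add: \<kappa>_def)
  then have lin: "linear_map K G (Inn K H) (\<lambda>x. \<kappa> x y)" "linear_map K G (Inn K H) (\<lambda>x. \<kappa> y x)"
    if "y \<in> carrier G" for y
    using that \<kappa> by (simp_all add: linear_map_def Pi_iff)
  have \<kappa>0: "\<kappa> x x = \<zero>\<^bsub>Der K H\<^esub>" if "x \<in> carrier G" for x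
    using that linear_map_zero[OF lift_linear[OF s] G.abelian_group_carrier D.abelian_group_carrier]
    by (simp add: \<kappa>_def lc D.bracket_self G.bracket_self char_ne_2 D.M.diff_self)
  have \<kappa>phi: "phi (Der K H) (\<kappa> x y) = \<kappa> (phi G x) (phi G y)" if "x \<in> carrier G" "y \<in> carrier G" for x y
    using that by (simp add: \<kappa>_def c D.phi_diff D.phi_bracket G.phi_closed flip: lift_phi[OF s] G.phi_bracket)
  define \<omega> where "\<omega> = (\<lambda>xs\<in>tuples 2 G. t (\<kappa> (xs ! 0) (xs ! 1)))"
  have \<omega>pair: "\<omega> [x, y] = t (\<kappa> x y)" if "x \<in> carrier G" "y \<in> carrier G" for x y
    using that by (simp add: \<omega>_def pair_tuples)
  have "lifting_data K G H rbar s \<omega>"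
    unfolding lifting_data_def
  proof (intro conjI ballI)
    show "lift_section s" by fact
    show "\<omega> \<in> alternating_maps K 2 G H"
    proof (rule alternating_maps_2I, goal_cases)
      case 1 show ?case by (simp add: \<omega>_def)
    next
      case (2 y) then show ?case using linear_map_comp[OF lin(1)[OF 2] t(1)]
        by (simp add: linear_map_def Pi_iff \<omega>pair)
    next
      case (3 y) then show ?case using linear_map_comp[OF lin(2)[OF 3] t(1)]
        by (simp add: linear_map_def Pi_iff \<omega>pair)
    next
      case (4 x) then show ?case
        using linear_map_zero[OF t(1) I.abelian_group_carrier H.abelian_group_carrier]
        by (simp add: \<omega>pair \<kappa>0)
    qed
    fix x y assume "x \<in> carrier G" "y \<in> carrier G"
    then show "phi H (\<omega> [x, y]) = \<omega> [phi G x, phi G y]"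
      "s (rbar x) \<otimes>\<^bsub>Der K H\<^esub> s (rbar y) \<ominus>\<^bsub>Der K H\<^esub> s (rbar (x \<otimes>\<^bsub>G\<^esub> y)) = ad H (\<omega> [x, y])"
      using \<kappa> t by (simp_all add: \<omega>pair G.phi_closed \<kappa>phi) (simp add: \<kappa>_def)
  qed
  then show ?thesis by blast
qed

section \<open>Independence of the choices\<close>

abbreviation obstruction :: "(('b \<Rightarrow> 'b) set \<Rightarrow> 'b \<Rightarrow> 'b) \<Rightarrow> ('a list \<Rightarrow> 'b) \<Rightarrow> 'a list \<Rightarrow> 'b" where
  "obstruction s \<omega> \<equiv> (\<lambda>xs\<in>tuples 3 G.
     formal_coboundary G H (\<lambda>x. s (rbar x)) \<omega> (xs ! 0) (xs ! 1) (xs ! 2))"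

abbreviation central_coboundary :: "('a list \<Rightarrow> 'b) \<Rightarrow> 'a list \<Rightarrow> 'b" where
  "central_coboundary \<equiv> coboundary K 2 G (Cen H) (center_rep K G H rbar)"

lemma central_coboundary_eq:
  assumes "lifting_data K G H rbar s \<omega>" "\<theta> \<in> cochains K 2 G (Cen H) (phi H)"
  shows "central_coboundary \<theta> = obstruction s \<theta>"
proof -
  interpret twisted_action K G H "\<lambda>x. s (rbar x)" \<omega>
    by (rule lifting_data_twisted_action[OF assms(1)])
  have s: "lift_section s" using assms by (simp add: lifting_data_def)
  have \<theta>: "\<theta> \<in> alternating_maps K 2 G (Cen H)" using assms by (simp add: cochains_def)
  show ?thesis
  proof (rule extensionalityI)
    show "central_coboundary \<theta> \<in> extensional (tuples 3 G)"
      by (simp add: coboundary_def)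
    show "obstruction s \<theta> \<in> extensional (tuples 3 G)" by simp
    fix xs assume "xs \<in> tuples 3 G"
    then show "central_coboundary \<theta> xs = obstruction s \<theta> xs"
      using coboundary_eq_formal_coboundary[OF Cen_module \<theta>]
      by (auto elim!: tuples_3E simp: center_rep_eq[OF s] triple_tuples)
  qed
qed

text \<open>
  With a diagonal section \<open>t\<close> of \<open>ad\<close>, the map \<open>b x = t (s' (rbar x) - s (rbar x))\<close> describes the passage
  from \<open>s\<close> to \<open>s'\<close> as a gauge change.  It turns \<open>\<omega>\<close> into a map \<open>omega'\<close> that satisfies the same curvature
  equation as \<open>\<omega>'\<close>, so that \<open>\<theta> = \<omega>' - omega'\<close> is centre-valued.
\<close>

lemma obstruction_shift:
  assumes "lifting_data K G H rbar s \<omega>" "lifting_data K G H rbar s' \<omega>'"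
  shows "\<exists>\<theta>\<in>cochains K 2 G (Cen H) (phi H). \<forall>x\<in>carrier G. \<forall>y\<in>carrier G. \<forall>z\<in>carrier G.
     formal_coboundary G H (\<lambda>x. s' (rbar x)) \<omega>' x y z
       = formal_coboundary G H (\<lambda>x. s (rbar x)) \<omega> x y z
         \<oplus>\<^bsub>H\<^esub> formal_coboundary G H (\<lambda>x. s' (rbar x)) \<theta> x y z"
proof -
  have s: "lift_section s" and s': "lift_section s'" using assms by (auto simp: lifting_data_def)
  obtain t where "diagonal_section K H (ad H) (Inn K H) t"
    using diagonal_section_exists[OF Inn_diagonal] by blast
  then have t: "linear_map K (Inn K H) H t" "\<And>A. A \<in> ad H ` carrier H \<Longrightarrow> ad H (t A) = A"
    "\<And>A. A \<in> ad H ` carrier H \<Longrightarrow> phi H (t A) = t (phi (Der K H) A)"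
    by (auto simp: diagonal_section_def)
  define \<delta> where "\<delta> x = s' (rbar x) \<ominus>\<^bsub>Der K H\<^esub> s (rbar x)" for x
  have \<delta>: "\<delta> x \<in> ad H ` carrier H" if "x \<in> carrier G" for x
    using lift_difference[OF s s' that] by (simp add: \<delta>_def)
  have "linear_map K G (Der K H) \<delta>"
    using linear_map_pointwise_diff[OF D.module_carrier lift_linear[OF s'] lift_linear[OF s]]
    unfolding \<delta>_def .
  then have "linear_map K G (Inn K H) \<delta>"
    using \<delta> by (simp add: linear_map_def Pi_iff)
  then have b_linear: "linear_map K G H (\<lambda>x. t (\<delta> x))"
    by (rule linear_map_comp[OF _ t(1)])
  have b_phi: "t (\<delta> (phi G x)) = phi H (t (\<delta> x))" if "x \<in> carrier G" for x
    using that \<delta> t(3)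
    by (simp add: \<delta>_def lift_phi[OF s] lift_phi[OF s'] lift_closed[OF s] lift_closed[OF s'] D.phi_diff)
  interpret gauge_change K G H "\<lambda>x. s (rbar x)" \<omega> "\<lambda>x. t (\<delta> x)"
    using lifting_data_twisted_action[OF assms(1)] b_linear b_phi
    by (simp add: gauge_change_def gauge_change_axioms_def)
  interpret T': twisted_action K G H "\<lambda>x. s' (rbar x)" \<omega>'
    by (rule lifting_data_twisted_action[OF assms(2)])
  have rho': "rho' x u = s' (rbar x) u" if "x \<in> carrier G" "u \<in> carrier H" for x u
  proof -
    have "\<delta> x u = t (\<delta> x) \<otimes>\<^bsub>H\<^esub> u"
      using fun_cong[OF t(2)[OF \<delta>[OF that(1)]], of u] that by (simp add: ad_def)
    then have "t (\<delta> x) \<otimes>\<^bsub>H\<^esub> u = s' (rbar x) u \<ominus>\<^bsub>H\<^esub> s (rbar x) u"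
      using that by (simp add: \<delta>_def Der_diff lift_closed[OF s] lift_closed[OF s'])
    then show ?thesis
      using that by (simp add: rho'_def rho_closed T'.rho_closed H.M.transpose_simps H.M.a_ac H.M.diff_self)
  qed
  define \<theta> where "\<theta> = (\<lambda>xs\<in>tuples 2 G. \<omega>' xs \<ominus>\<^bsub>H\<^esub> omega' xs)"
  have \<theta>pair: "\<theta> [x, y] = \<omega>' [x, y] \<ominus>\<^bsub>H\<^esub> omega' [x, y]" if "x \<in> carrier G" "y \<in> carrier G" for x y
    using that by (simp add: \<theta>_def pair_tuples)
  have \<theta>center: "\<theta> [x, y] \<in> center H" if xy: "x \<in> carrier G" "y \<in> carrier G" for x y
  proof (rule H.centerI)
    show "\<theta> [x, y] \<in> carrier H" using that by (simp add: \<theta>pair T'.omega_closed omega'_closed)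
    fix u assume u: "u \<in> carrier H"
    have "omega' [x, y] \<otimes>\<^bsub>H\<^esub> phi H u = \<omega>' [x, y] \<otimes>\<^bsub>H\<^esub> phi H u"
      using rho'_curvature[OF xy u] T'.curvature[OF xy u] xy u
      by (simp add: rho' T'.rho_closed G.phi_closed G.bracket_closed H.phi_closed)
    then show "\<theta> [x, y] \<otimes>\<^bsub>H\<^esub> phi H u = \<zero>\<^bsub>H\<^esub>"
      using xy u by (simp add: \<theta>pair H.bracket_diff_left T'.omega_closed omega'_closed H.phi_closed
        H.bracket_closed H.M.diff_self)
  qed
  have \<theta>alt: "\<theta> \<in> alternating_maps K 2 G (Cen H)"
    using alternating_maps_2_diff[OF G.module_carrier H.module_carrier T'.omega_alternating omega'_alternating]
      \<theta>center by (intro alternating_maps_2_CenI) (auto simp: \<theta>_def)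
  have "\<theta> \<in> cochains K 2 G (Cen H) (phi H)"
    unfolding cochains_def using \<theta>alt
    by (auto elim!: tuples_2E simp: \<theta>pair T'.omega_closed omega'_closed H.phi_diff T'.omega_phi omega'_phi G.phi_closed)
  moreover have "formal_coboundary G H (\<lambda>x. s' (rbar x)) \<omega>' x y z
       = formal_coboundary G H (\<lambda>x. s (rbar x)) \<omega> x y z
         \<oplus>\<^bsub>H\<^esub> formal_coboundary G H (\<lambda>x. s' (rbar x)) \<theta> x y z"
    if xyz: "x \<in> carrier G" "y \<in> carrier G" "z \<in> carrier G" for x y z
  proof -
    have "formal_coboundary G H (\<lambda>x. s' (rbar x)) \<omega>' x y z
       = formal_coboundary G H (\<lambda>x. s' (rbar x)) omega' x y z
         \<oplus>\<^bsub>H\<^esub> formal_coboundary G H (\<lambda>x. s' (rbar x)) \<theta> x y z"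
      using xyz by (intro T'.formal_coboundary_add omega'_alternating alternating_maps_Cen[OF \<theta>alt])
        (simp_all add: \<theta>pair T'.omega_closed omega'_closed H.M.transpose_simps H.M.a_ac H.M.diff_self)
    also have "formal_coboundary G H (\<lambda>x. s' (rbar x)) omega' x y z = formal_coboundary G H rho' omega' x y z"
      by (rule formal_coboundary_cong[OF _ _ G.hom_lie_algebra_axioms xyz]) (simp_all add: rho' omega'_closed)
    also have "\<dots> = formal_coboundary G H (\<lambda>x. s (rbar x)) \<omega> x y z"
      by (rule formal_coboundary_gauge[OF xyz])
    finally show ?thesis .
  qed
  ultimately show ?thesis by blast
qed

lemma cohomology_class_member:
  "g \<in> cohomology_class K 3 G (Cen H) (phi H) (center_rep K G H rbar) f \<longleftrightarrow>
     (\<exists>\<theta>\<in>cochains K 2 G (Cen H) (phi H).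
        g = (\<lambda>xs\<in>tuples 3 G. central_coboundary \<theta> xs \<oplus>\<^bsub>H\<^esub> f xs))"
  by (auto simp: cohomology_class_def a_r_coset_def' coboundaries_def cochain_module_def)

text \<open>
  By the previous shift a member \<open>d \<eta> + obstruction s' \<omega>'\<close> of the first class equals
  \<open>d (\<eta> + \<theta>) + obstruction s \<omega>\<close>.
\<close>

lemma cohomology_class_subset:
  assumes L: "lifting_data K G H rbar s \<omega>" and L': "lifting_data K G H rbar s' \<omega>'"
  shows "cohomology_class K 3 G (Cen H) (phi H) (center_rep K G H rbar) (obstruction s' \<omega>')
     \<subseteq> cohomology_class K 3 G (Cen H) (phi H) (center_rep K G H rbar) (obstruction s \<omega>)"
proof
  interpret T: twisted_action K G H "\<lambda>x. s (rbar x)" \<omega>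
    by (rule lifting_data_twisted_action[OF L])
  interpret T': twisted_action K G H "\<lambda>x. s' (rbar x)" \<omega>'
    by (rule lifting_data_twisted_action[OF L'])
  obtain \<theta> where \<theta>: "\<theta> \<in> cochains K 2 G (Cen H) (phi H)"
    and eq: "\<And>x y z. x \<in> carrier G \<Longrightarrow> y \<in> carrier G \<Longrightarrow> z \<in> carrier G \<Longrightarrow>
     formal_coboundary G H (\<lambda>x. s' (rbar x)) \<omega>' x y z
       = formal_coboundary G H (\<lambda>x. s (rbar x)) \<omega> x y z
         \<oplus>\<^bsub>H\<^esub> formal_coboundary G H (\<lambda>x. s' (rbar x)) \<theta> x y z"
    using obstruction_shift[OF L L'] by blast
  fix g assume "g \<in> cohomology_class K 3 G (Cen H) (phi H) (center_rep K G H rbar) (obstruction s' \<omega>')"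
  then obtain \<eta> where \<eta>: "\<eta> \<in> cochains K 2 G (Cen H) (phi H)"
    and g: "g = (\<lambda>xs\<in>tuples 3 G. central_coboundary \<eta> xs \<oplus>\<^bsub>H\<^esub> obstruction s' \<omega>' xs)"
    unfolding cohomology_class_member by blast
  define \<zeta> where "\<zeta> = (\<lambda>xs\<in>tuples 2 G. \<eta> xs \<oplus>\<^bsub>H\<^esub> \<theta> xs)"
  have \<zeta>: "\<zeta> \<in> cochains K 2 G (Cen H) (phi H)"
    unfolding \<zeta>_def using cochains_add[OF Cen_module G.hom_lie_algebra_axioms H.hom_lie_algebra_axioms \<eta> \<theta>] .
  have alt: "\<theta> \<in> alternating_maps K 2 G H" "\<eta> \<in> alternating_maps K 2 G H"
    using \<theta> \<eta> by (auto simp: cochains_def intro: alternating_maps_Cen)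
  have "central_coboundary \<eta> xs \<oplus>\<^bsub>H\<^esub> obstruction s' \<omega>' xs = central_coboundary \<zeta> xs \<oplus>\<^bsub>H\<^esub> obstruction s \<omega> xs"
    if xs3: "xs \<in> tuples 3 G" for xs
  proof -
    obtain x y z where xs: "xs = [x, y, z]" and xyz: "x \<in> carrier G" "y \<in> carrier G" "z \<in> carrier G"
      using tuples_3E[OF xs3] by blast
    have fa: "formal_coboundary G H (\<lambda>x. s' (rbar x)) \<zeta> x y z
       = formal_coboundary G H (\<lambda>x. s' (rbar x)) \<eta> x y z \<oplus>\<^bsub>H\<^esub> formal_coboundary G H (\<lambda>x. s' (rbar x)) \<theta> x y z"
      by (rule T'.formal_coboundary_add[OF alt(2,1) _ xyz]) (simp add: \<zeta>_def pair_tuples)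
    show ?thesis
      using xyz
      by (simp add: xs triple_tuples central_coboundary_eq[OF L' \<zeta>] central_coboundary_eq[OF L' \<eta>] eq fa
        T'.formal_coboundary_closed[OF alt(1)] T'.formal_coboundary_closed[OF alt(2)]
        T.formal_coboundary_closed[OF T.omega_alternating] H.M.a_ac)
  qed
  then show "g \<in> cohomology_class K 3 G (Cen H) (phi H) (center_rep K G H rbar) (obstruction s \<omega>)"
    unfolding cohomology_class_member g using \<zeta> by (auto intro!: bexI[of _ \<zeta>])
qed

lemma obstruction_class_eq:
  assumes "lifting_data K G H rbar s \<omega>"
  shows "obstruction_class K G H rbar
     = cohomology_class K 3 G (Cen H) (phi H) (center_rep K G H rbar) (obstruction s \<omega>)"
  unfolding obstruction_class_def
proof (rule the_equality, goal_cases)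
  case 1 show ?case using assms by blast
next
  case (2 c)
  then obtain s' \<omega>' where L': "lifting_data K G H rbar s' \<omega>'"
    and c: "c = cohomology_class K 3 G (Cen H) (phi H) (center_rep K G H rbar) (obstruction s' \<omega>')"
    by blast
  show ?case
    unfolding c by (intro subset_antisym cohomology_class_subset assms L')
qed

lemma central_coboundary_zero:
  assumes L: "lifting_data K G H rbar s \<omega>"
  shows "(\<lambda>xs\<in>tuples 2 G. \<zero>\<^bsub>H\<^esub>) \<in> cochains K 2 G (Cen H) (phi H)"
    and "central_coboundary (\<lambda>xs\<in>tuples 2 G. \<zero>\<^bsub>H\<^esub>) = (\<lambda>xs\<in>tuples 3 G. \<zero>\<^bsub>H\<^esub>)"
proof -
  interpret twisted_action K G H "\<lambda>x. s (rbar x)" \<omega>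
    by (rule lifting_data_twisted_action[OF L])
  note ag = H.abelian_group_carrier
  let ?z = "\<lambda>xs\<in>tuples 2 G. \<zero>\<^bsub>H\<^esub>"
  have zc: "\<zero>\<^bsub>H\<^esub> \<in> center H"
    using linear_map_zero[OF H.linear_map_bracket_left ag ag] by (simp add: center_def)
  have "?z \<in> alternating_maps K 2 G (Cen H)"
    using zc by (intro alternating_maps_2I)
      (auto simp: linear_map_def pair_tuples)
  then show z: "?z \<in> cochains K 2 G (Cen H) (phi H)"
    using linear_map_zero[OF H.phi_linear ag ag]
    by (auto simp: cochains_def pair_tuples G.phi_closed elim!: tuples_2E)
  have "formal_coboundary G H (\<lambda>x. s (rbar x)) ?z x y z = \<zero>\<^bsub>H\<^esub>"
    if "x \<in> carrier G" "y \<in> carrier G" "z \<in> carrier G" for x y z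
    using that linear_map_zero[OF rho_linear ag ag]
    by (simp add: formal_coboundary_def pair_tuples G.phi_closed G.bracket_closed H.M.diff_self)
  then show "central_coboundary ?z = (\<lambda>xs\<in>tuples 3 G. \<zero>\<^bsub>H\<^esub>)"
    unfolding central_coboundary_eq[OF L z] by (intro restrict_ext) (auto elim!: tuples_3E)
qed

lemma zero_cohomology:
  "\<zero>\<^bsub>cohomology K 3 G (Cen H) (phi H) (center_rep K G H rbar)\<^esub>
     = central_coboundary ` cochains K 2 G (Cen H) (phi H)"
  by (simp add: cohomology_def fact_module_def coboundaries_def)

lemma obstruction_class_zeroI:
  assumes L: "lifting_data K G H rbar s \<omega>"
    and "\<And>x y z. x \<in> carrier G \<Longrightarrow> y \<in> carrier G \<Longrightarrow> z \<in> carrier G \<Longrightarrow>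
      formal_coboundary G H (\<lambda>x. s (rbar x)) \<omega> x y z = \<zero>\<^bsub>H\<^esub>"
  shows "obstruction_class K G H rbar = \<zero>\<^bsub>cohomology K 3 G (Cen H) (phi H) (center_rep K G H rbar)\<^esub>"
proof -
  interpret twisted_action K G H "\<lambda>x. s (rbar x)" \<omega>
    by (rule lifting_data_twisted_action[OF L])
  have *: "(\<lambda>xs\<in>tuples 3 G. central_coboundary \<theta> xs \<oplus>\<^bsub>H\<^esub> obstruction s \<omega> xs) = central_coboundary \<theta>"
    if \<theta>: "\<theta> \<in> cochains K 2 G (Cen H) (phi H)" for \<theta>
  proof -
    have "\<theta> \<in> alternating_maps K 2 G H"
      using \<theta> by (auto simp: cochains_def intro: alternating_maps_Cen)
    then show ?thesis
      unfolding central_coboundary_eq[OF L \<theta>] using assms(2)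
      by (intro restrict_ext) (auto elim!: tuples_3E simp: triple_tuples formal_coboundary_closed)
  qed
  show ?thesis
    unfolding obstruction_class_eq[OF L] zero_cohomology
    by (intro Set.set_eqI) (simp only: cohomology_class_member image_iff * cong: bex_cong)
qed

text \<open>
  Central changes of \<open>\<omega>\<close> are invisible to \<open>ad\<close>.
\<close>

lemma lifting_data_diff:
  assumes L: "lifting_data K G H rbar s \<omega>" and \<theta>: "\<theta> \<in> cochains K 2 G (Cen H) (phi H)"
  shows "lifting_data K G H rbar s (\<lambda>xs\<in>tuples 2 G. \<omega> xs \<ominus>\<^bsub>H\<^esub> \<theta> xs)"
proof -
  interpret twisted_action K G H "\<lambda>x. s (rbar x)" \<omega>
    by (rule lifting_data_twisted_action[OF L])
  have \<theta>C: "\<theta> \<in> alternating_maps K 2 G (Cen H)"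
    and p: "\<And>xs. xs \<in> tuples 2 G \<Longrightarrow> phi H (\<theta> xs) = \<theta> (map (phi G) xs)"
    using \<theta> by (auto simp: cochains_def)
  have c: "\<theta> [x, y] \<in> center H" if "x \<in> carrier G" "y \<in> carrier G" for x y
    using linear_map_closed[OF alternating_maps_2_linear_right[OF \<theta>C that(1)]] that(2) by simp
  have "ad H (\<omega> [x, y] \<ominus>\<^bsub>H\<^esub> \<theta> [x, y]) = ad H (\<omega> [x, y])" if "x \<in> carrier G" "y \<in> carrier G" for x y
    using that c by (auto simp: ad_def H.bracket_diff_left omega_closed center_carrier center_bracket
      H.bracket_closed H.M.diff_zero intro!: restrict_ext)
  then show ?thesis
    using L alternating_maps_2_diff[OF G.module_carrier H.module_carrier omega_alternating alternating_maps_Cen[OF \<theta>C]]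
      p[of "[_, _]"] c
    by (simp add: lifting_data_def pair_tuples G.phi_closed H.phi_diff omega_closed omega_phi center_carrier)
qed

lemma extensible_iff:
  "extensible K G H rbar \<longleftrightarrow>
     obstruction_class K G H rbar = \<zero>\<^bsub>cohomology K 3 G (Cen H) (phi H) (center_rep K G H rbar)\<^esub>"
proof
  assume "extensible K G H rbar"
  then show "obstruction_class K G H rbar = \<zero>\<^bsub>cohomology K 3 G (Cen H) (phi H) (center_rep K G H rbar)\<^esub>"
    unfolding extensible_def using obstruction_class_zeroI by blast
next
  assume zero: "obstruction_class K G H rbar = \<zero>\<^bsub>cohomology K 3 G (Cen H) (phi H) (center_rep K G H rbar)\<^esub>"
  obtain s \<omega> where L: "lifting_data K G H rbar s \<omega>" using lifting_data_exists by blast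
  interpret T: twisted_action K G H "\<lambda>x. s (rbar x)" \<omega>
    by (rule lifting_data_twisted_action[OF L])
  have "obstruction s \<omega> \<in> obstruction_class K G H rbar"
    unfolding obstruction_class_eq[OF L] cohomology_class_member
    by (intro bexI[OF _ central_coboundary_zero(1)[OF L]] restrict_ext, unfold central_coboundary_zero(2)[OF L])
      (auto elim!: tuples_3E simp: triple_tuples T.formal_coboundary_closed[OF T.omega_alternating])
  then obtain \<theta> where \<theta>: "\<theta> \<in> cochains K 2 G (Cen H) (phi H)" and "obstruction s \<omega> = central_coboundary \<theta>"
    unfolding zero zero_cohomology by blast
  then have eq: "obstruction s \<omega> xs = obstruction s \<theta> xs" for xs
    by (simp only: central_coboundary_eq[OF L \<theta>])
  define \<omega>' where "\<omega>' = (\<lambda>xs\<in>tuples 2 G. \<omega> xs \<ominus>\<^bsub>H\<^esub> \<theta> xs)"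
  have L': "lifting_data K G H rbar s \<omega>'"
    unfolding \<omega>'_def by (rule lifting_data_diff[OF L \<theta>])
  interpret T': twisted_action K G H "\<lambda>x. s (rbar x)" \<omega>'
    by (rule lifting_data_twisted_action[OF L'])
  have \<theta>H: "\<theta> \<in> alternating_maps K 2 G H"
    using \<theta> by (auto simp: cochains_def intro: alternating_maps_Cen)
  have \<theta>c: "\<theta> [x, y] \<in> carrier H" if "x \<in> carrier G" "y \<in> carrier G" for x y
    using linear_map_closed[OF alternating_maps_2_linear_right[OF \<theta>H that(1)] that(2)] .
  have "formal_coboundary G H (\<lambda>x. s (rbar x)) \<omega>' x y z = \<zero>\<^bsub>H\<^esub>"
    if xyz: "x \<in> carrier G" "y \<in> carrier G" "z \<in> carrier G" for x y z
  proof -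
    have "formal_coboundary G H (\<lambda>x. s (rbar x)) \<omega> x y z
       = formal_coboundary G H (\<lambda>x. s (rbar x)) \<omega>' x y z \<oplus>\<^bsub>H\<^esub> formal_coboundary G H (\<lambda>x. s (rbar x)) \<theta> x y z"
      using xyz \<theta>c by (intro T.formal_coboundary_add T'.omega_alternating \<theta>H)
        (simp_all add: \<omega>'_def pair_tuples H.M.diff_add_cancel T.omega_closed)
    moreover have "formal_coboundary G H (\<lambda>x. s (rbar x)) \<omega> x y z = formal_coboundary G H (\<lambda>x. s (rbar x)) \<theta> x y z"
      using eq[of "[x, y, z]"] xyz by (simp add: triple_tuples)
    ultimately show ?thesis
      using T.formal_coboundary_closed[OF \<theta>H xyz] T.formal_coboundary_closed[OF T'.omega_alternating xyz]
      by (metis H.M.add.r_cancel_one)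
  qed
  then show "extensible K G H rbar"
    unfolding extensible_def using L' T.rho_phi by blast
qed

end

theorem theorem4p3:
  fixes K :: "('k, 'r) ring_scheme"
    and G :: "('k, 'a, 'm) hom_lie_scheme"
    and H :: "('k, 'b, 'n) hom_lie_scheme"
    and rbar :: "'a \<Rightarrow> ('b \<Rightarrow> 'b) set"
  assumes "algebraically_closed K"
    and char0: "\<forall>n::nat. n > 0 \<longrightarrow> [n] \<cdot>\<^bsub>K\<^esub> \<one>\<^bsub>K\<^esub> \<noteq> \<zero>\<^bsub>K\<^esub>"
    and "regular_hom_lie_algebra K G"
    and "regular_hom_lie_algebra K H"
    and "diagonal_extension K (Inn K H) (\<lambda>D. D) (Der K H) (out_proj K H) (Out K H)"
    and "diagonal_extension K (Cen H) (\<lambda>u. u) H (ad H) (Inn K H)"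
    and "hom_lie_morphism K G (Out K H) rbar"
  shows "extensible K G H rbar \<longleftrightarrow>
    obstruction_class K G H rbar =
      \<zero>\<^bsub>cohomology K 3 G (Cen H) (phi H) (center_rep K G H rbar)\<^esub>"
proof -
  interpret K: algebraically_closed K by fact
  have "\<one>\<^bsub>K\<^esub> \<oplus>\<^bsub>K\<^esub> \<one>\<^bsub>K\<^esub> \<noteq> \<zero>\<^bsub>K\<^esub>"
    using char0[rule_format, of 2] by (simp add: numeral_2_eq_2)
  with assms interpret outer_action K G H rbar
    by (simp add: outer_action_def outer_action_axioms_def)
  show ?thesis by (rule extensible_iff)
qed

end
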